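(* For $G$, $E_A$ and any $x\in\mathbb C^E$ as in the context, \[ Z(x)=1+\sum_{r=1}^\infty\sum_{s=1}^\infty\ \sum_{(\ell_1,\dots,\ell_s)\in\mathcal C_r}\frac1{s!}\prod_{i=1}^s w(\ell_i;x), \] where for each $r$ the inner double sum is a finite sum.
   Context: Setting: $G=(V,E)$ finite, no self-loops or multiple edges, embedded in $\mathbb R^2$ with straight-segment edges, no vertex in the interior of an edge; two edges cross if they meet at a non-vertex point. $E=E_A\sqcup(E\setminus E_A)$ with $(V,E_A)$ acyclic. Loops: a path $(v_0,\dots,v_{n-1})$ has $v_iv_{i+1}\in E$, $v_{i+2}\ne v_i$; closed if all rotations are paths; a loop is a closed path lexicographically smallest among rotations of itself and its reversal. $m(\ell)$ = steps / smallest period; winding angle = sum (mod $n$) of turning angles in $(-\pi,\pi)$; $\operatorname{sgn}(\ell)=-e^{i\alpha(\ell)/2}$; $w(\ell;x)=\frac{\operatorname{sgn}(\ell)}{m(\ell)}\prod_i x_{v_iv_{i+1}}$; length $r(\ell)$ = number of steps along $E\setminus E_A$. A loop configuration is an ordered sequence $(\ell_1,\dots,\ell_s)$ of loops (repetitions allowed, no disjointness required); $\mathcal C_r$ = configurations with $\sum_i r(\ell_i)=r$. $F\subseteq E$ even: all degrees in $(V,F)$ even; $C_F$ = number of unordered crossing pairs of edges in $F$; $Z(x)=\sum_{F\text{ even}}(-1)^{C_F}\prod_{e\in F}x_e$. *)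

theory Defs
  imports "HOL-Analysis.Analysis"
begin

definition plane_graph :: "'v set \<Rightarrow> 'v set set \<Rightarrow> ('v \<Rightarrow> complex) \<Rightarrow> bool" where
  "plane_graph V E pos \<longleftrightarrow>
     finite V \<and>
     E \<subseteq> {{a, b} | a b. a \<in> V \<and> b \<in> V \<and> a \<noteq> b} \<and>
     inj_on pos V \<and>
     (\<forall>a b v. {a, b} \<in> E \<longrightarrow> v \<in> V \<longrightarrow> pos v \<notin> open_segment (pos a) (pos b))"

definition acyclic_graph :: "'v set \<Rightarrow> 'v set set \<Rightarrow> bool" where
  "acyclic_graph V EA \<longleftrightarrow>
     \<not> (\<exists>vs. length vs \<ge> 3 \<and> distinct vs \<and> set vs \<subseteq> V \<and>
            (\<forall>i < length vs. {vs ! i, vs ! ((i + 1) mod length vs)} \<in> EA))"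

definition closed_gpath :: "'v set set \<Rightarrow> 'v list \<Rightarrow> bool" where
  "closed_gpath E vs \<longleftrightarrow> vs \<noteq> [] \<and>
     (\<forall>i < length vs. {vs ! i, vs ! ((i + 1) mod length vs)} \<in> E \<and>
                       vs ! ((i + 2) mod length vs) \<noteq> vs ! i)"

definition lex_le :: "'v::linorder list \<Rightarrow> 'v list \<Rightarrow> bool" where
  "lex_le xs ys \<longleftrightarrow> xs = ys \<or> (xs, ys) \<in> lexord {(a, b). a < b}"

definition is_gloop :: "'v set set \<Rightarrow> 'v::linorder list \<Rightarrow> bool" where
  "is_gloop E vs \<longleftrightarrow> closed_gpath E vs \<and>
     (\<forall>k. lex_le vs (rotate k vs) \<and> lex_le vs (rotate k (rev vs)))"

definition gloops :: "'v set set \<Rightarrow> 'v::linorder list set" where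
  "gloops E = {vs. is_gloop E vs}"

definition loop_mult :: "'v list \<Rightarrow> nat" where
  "loop_mult vs = length vs div (LEAST p. 0 < p \<and> rotate p vs = vs)"

definition turn_angle :: "('v \<Rightarrow> complex) \<Rightarrow> 'v list \<Rightarrow> nat \<Rightarrow> real" where
  "turn_angle pos vs i =
     (let n = length vs;
          vprev = vs ! ((i + n - 1) mod n); v = vs ! i; vnext = vs ! ((i + 1) mod n)
      in Arg ((pos vnext - pos v) / (pos v - pos vprev)))"

definition winding_angle :: "('v \<Rightarrow> complex) \<Rightarrow> 'v list \<Rightarrow> real" where
  "winding_angle pos vs = (\<Sum>i < length vs. turn_angle pos vs i)"

definition loop_sgn :: "('v \<Rightarrow> complex) \<Rightarrow> 'v list \<Rightarrow> complex" where
  "loop_sgn pos vs = - exp (\<i> * complex_of_real (winding_angle pos vs / 2))"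

definition loop_weight :: "('v \<Rightarrow> complex) \<Rightarrow> ('v set \<Rightarrow> complex) \<Rightarrow> 'v list \<Rightarrow> complex" where
  "loop_weight pos x vs =
     loop_sgn pos vs / of_nat (loop_mult vs) *
     (\<Prod>i < length vs. x {vs ! i, vs ! ((i + 1) mod length vs)})"

definition loop_len :: "'v set set \<Rightarrow> 'v list \<Rightarrow> nat" where
  "loop_len EA vs = card {i. i < length vs \<and> {vs ! i, vs ! ((i + 1) mod length vs)} \<notin> EA}"

definition loop_configs :: "'v set set \<Rightarrow> 'v set set \<Rightarrow> nat \<Rightarrow> 'v::linorder list list set" where
  "loop_configs E EA r = {c. set c \<subseteq> gloops E \<and> sum_list (map (loop_len EA) c) = r}"

definition even_subgraph :: "'v set \<Rightarrow> 'v set set \<Rightarrow> 'v set set \<Rightarrow> bool" where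
  "even_subgraph V E F \<longleftrightarrow> F \<subseteq> E \<and> (\<forall>v \<in> V. even (card {e \<in> F. v \<in> e}))"

definition edges_cross :: "'v set \<Rightarrow> ('v \<Rightarrow> complex) \<Rightarrow> 'v set \<Rightarrow> 'v set \<Rightarrow> bool" where
  "edges_cross V pos e f \<longleftrightarrow>
     (\<exists>p. p \<in> convex hull (pos ` e) \<and> p \<in> convex hull (pos ` f) \<and> p \<notin> pos ` V)"

definition num_crossings :: "'v set \<Rightarrow> ('v \<Rightarrow> complex) \<Rightarrow> 'v set set \<Rightarrow> nat" where
  "num_crossings V pos F = card {{e, f} | e f. e \<in> F \<and> f \<in> F \<and> e \<noteq> f \<and> edges_cross V pos e f}"

definition Zpart :: "'v set \<Rightarrow> 'v set set \<Rightarrow> ('v \<Rightarrow> complex) \<Rightarrow> ('v set \<Rightarrow> complex) \<Rightarrow> complex" where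
  "Zpart V E pos x = (\<Sum>F \<in> {F. even_subgraph V E F}.
       (-1) ^ num_crossings V pos F * (\<Prod>e \<in> F. x e))"

end

(*
Split every edge into two half-edges and order all half-edges linearly: first by their
base vertex (swept from bottom to top), then by the angle at which they leave it.  The factor
exp(i * angle / 2) of a turn is, up to a coboundary, a sign that only depends on this order, so loop
signs become products of signs.

For an even subgraph F, sweeping the drawing from bottom to top shows that the number of crossings
has the parity of the number of interleaved pairs of edges, seen as chords of the linear order: the
error terms count (edge passing to the left of v, half-edge of F at v) and the degrees are even.
Hence Z = sum over S of Pf(K_S) Pf(X_S), where K is the sign kernel within a vertex and X the edge
matching.  Expanding the Pfaffian of K along a row (Wick's rule for the functional "bracket") moves
a marked half-edge by one nonbacktracking step, and iterating gives the Newton-type identity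
2 n Z_n = sum_k Z_(n-k) T_k, with T_k the signed sum of closed walks of length k.  Grouping closed
walks into loops, this says that Z and exp (sum over loops of w) have the same logarithmic
derivative.  Rescaling x outside E_A then refines the grading.
*)

theory Submission
  imports Defs
begin

section \<open>Signed subset functionals and the Newton-type recursion\<close>

text \<open>Every identity is stated in a fixed degree, where all sums are finite, so nothing has to
  converge: the exponential of the loop sum is a composition of formal power series. Grading by
  total length makes each degree finite in any graph; grading by steps outside \<open>EA\<close>
  does so because a closed nonbacktracking walk cannot stay inside a forest, and this is where
  acyclicity enters.

  No Pfaffian is ever formed. An antisymmetric kernel with all entries 1 above the diagonal has
  Pfaffian 1 in every even size, so its Gaussian functional is a plain indicator, and Wick's rule
  for it comes down to one alternating sum inside a block.

  The sign of a turn has two parts: whether the incoming step goes up or down in the order of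
  half-edges, and which of the two half-edges at the vertex comes first. The former belongs to an
  edge, the latter to a vertex; this separates the sign into an edge matching and a vertex kernel.

  The 2 in the recursion counts the two halves of an edge; on the loop side it counts the two
  orientations of a loop.\<close>

lemma alternating_sum_rank:
  fixes key :: "'h \<Rightarrow> nat"
  assumes "finite B" "inj_on key B"
  shows "(\<Sum>c\<in>B. (-1) ^ card {h\<in>B. key h < key c}) = (if odd (card B) then 1 else (0::complex))"
  using assms
proof (induction B rule: finite_ranking_induct[where f = key])
  case empty
  then show ?case by simp
next
  case (insert m S)
  show ?case
  proof (cases "m \<in> S")
    case True
    then show ?thesis using insert by (simp add: insert_absorb)
  next
    case False
    have lt: "key y < key m" if "y \<in> S" for y
      using insert.hyps(2)[OF that] insert.prems that False
      by (metis inj_onD insertCI le_neq_implies_less)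
    have 1: "{h \<in> insert m S. key h < key m} = S" using lt by auto
    have 2: "{h \<in> insert m S. key h < key c} = {h \<in> S. key h < key c}" if "c \<in> S" for c
      using lt[OF that] by auto
    have "(\<Sum>c\<in>insert m S. (-1) ^ card {h\<in>insert m S. key h < key c}) =
        (-1) ^ card S + (\<Sum>c\<in>S. (-1) ^ card {h\<in>S. key h < key c} :: complex)"
      using False insert.hyps(1) 1 2 by simp
    then show ?thesis using insert False by auto
  qed
qed

text \<open>\<open>H\<close> models the half-edges, \<open>bar\<close> passes to the other half of
  an edge and \<open>blk\<close> gives the base vertex. The only trace of geometry is
  \<open>blk_convex\<close>: blocks are intervals of the order, so the signs of different blocks do
  not interact.\<close>

locale ordered_matching =
  fixes H :: "'h set" and key :: "'h \<Rightarrow> nat" and bar :: "'h \<Rightarrow> 'h"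
    and blk :: "'h \<Rightarrow> 'b" and x :: "'h \<Rightarrow> complex"
  assumes fin: "finite H" and key_inj: "inj_on key H"
    and bar_in: "a \<in> H \<Longrightarrow> bar a \<in> H" and bar_bar: "a \<in> H \<Longrightarrow> bar (bar a) = a"
    and bar_ne: "a \<in> H \<Longrightarrow> bar a \<noteq> a" and x_bar: "a \<in> H \<Longrightarrow> x (bar a) = x a"
    and blk_convex: "\<lbrakk>a \<in> H; b \<in> H; c \<in> H; key a < key b; key b < key c; blk a = blk c\<rbrakk> \<Longrightarrow> blk b = blk a"
begin

definition rank :: "'h \<Rightarrow> 'h set \<Rightarrow> nat" where
  "rank a S = card {h\<in>S. key h < key a}"

definition even_blocks :: "'h set \<Rightarrow> bool" where
  "even_blocks S \<longleftrightarrow> (\<forall>v. even (card {h\<in>S. blk h = v}))"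

text \<open>The Pfaffian of the kernel \<open>turn\<close> below, restricted to \<open>S\<close>, is 1 if every block of \<open>S\<close> has even size and 0
  otherwise; so \<open>bracket\<close> is the Gaussian (Grassmann) integral with covariance \<open>turn\<close>.\<close>

definition bracket :: "('h set \<Rightarrow> complex) \<Rightarrow> complex" where
  "bracket f = (\<Sum>S\<in>Pow H. of_bool (even_blocks S) * f S)"

text \<open>On coefficient functions, \<open>create a\<close> is left multiplication by the
  Grassmann generator of \<open>a\<close>, and \<open>annih a\<close> below is the left derivative
  in it; the rank counts the generators that have to be passed.\<close>

definition create :: "'h \<Rightarrow> ('h set \<Rightarrow> complex) \<Rightarrow> 'h set \<Rightarrow> complex" where
  "create a f S = (if a \<in> S then (-1) ^ rank a S * f (S - {a}) else 0)"

definition annih :: "'h \<Rightarrow> ('h set \<Rightarrow> complex) \<Rightarrow> 'h set \<Rightarrow> complex" where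
  "annih a f S = (if a \<notin> S then (-1) ^ rank a S * f (insert a S) else 0)"

text \<open>The value 0 at equal keys is what excludes backtracking later on:
  \<open>turn (bar c) d\<close> vanishes at \<open>d = bar c\<close>.\<close>

definition turn :: "'h \<Rightarrow> 'h \<Rightarrow> complex" where
  "turn b c = (if blk b = blk c then if key b < key c then 1 else if key c < key b then -1 else 0 else 0)"

definition dirsgn :: "'h \<Rightarrow> complex" where
  "dirsgn a = (if key a < key (bar a) then 1 else -1)"

lemma key_eq: "a \<in> H \<Longrightarrow> b \<in> H \<Longrightarrow> key a = key b \<longleftrightarrow> a = b"
  using key_inj by (auto dest: inj_onD)

lemma finS: "S \<subseteq> H \<Longrightarrow> finite S"
  using fin finite_subset by blast

lemma rank_insert: "finite S \<Longrightarrow> c \<notin> S \<Longrightarrow> rank a (insert c S) = rank a S + of_bool (key c < key a)"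
proof -
  assume *: "finite S" "c \<notin> S"
  have "{h \<in> insert c S. key h < key a} =
      (if key c < key a then insert c {h \<in> S. key h < key a} else {h \<in> S. key h < key a})"
    by auto
  then show ?thesis using * by (simp add: rank_def)
qed

lemma rank_remove:
  assumes "finite S" "c \<in> S"
  shows "rank a S = rank a (S - {c}) + of_bool (key c < key a)"
  using rank_insert[of "S - {c}" c a] assms by (simp add: insert_absorb)

lemma rank_remove_self [simp]: "rank a (S - {a}) = rank a S"
  unfolding rank_def by (rule arg_cong[of _ _ card]) auto

lemma rank_insert_self [simp]: "rank a (insert a S) = rank a S"
  unfolding rank_def by (rule arg_cong[of _ _ card]) auto

text \<open>The canonical anticommutation relation. For distinct \<open>a\<close> and
  \<open>c\<close> exactly one of them lies below the other, so changing the order of the operations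
  shifts exactly one of the two ranks by one. For \<open>a = c\<close> exactly one of the two
  products survives, depending on whether \<open>a \<in> S\<close>.\<close>

lemma annih_create:
  assumes "S \<subseteq> H" "a \<in> H" "c \<in> H"
  shows "annih c (create a f) S = of_bool (a = c) * f S - create a (annih c f) S"
proof (cases "a = c")
  case True
  then show ?thesis
    by (auto simp: annih_def create_def insert_absorb power_add[symmetric] mult.assoc[symmetric])
next
  case False
  have "finite S" using finS assms by blast
  have key: "key a \<noteq> key c" using key_eq assms False by blast
  show ?thesis
  proof (cases "a \<in> S \<and> c \<notin> S")
    case True
    have 1: "insert c S - {a} = insert c (S - {a})" using False by auto
    have 2: "rank a (insert c S) = rank a S + of_bool (key c < key a)"
      using rank_insert True \<open>finite S\<close> by blast
    have 3: "rank c S = rank c (S - {a}) + of_bool (key a < key c)"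
      using rank_remove True \<open>finite S\<close> by blast
    show ?thesis using True False key
      by (auto simp: annih_def create_def 1 2 3 power_add)
  next
    case False
    then show ?thesis using \<open>a \<noteq> c\<close> by (auto simp: annih_def create_def)
  qed
qed

lemma create_create:
  assumes "S \<subseteq> H" "a \<in> H" "c \<in> H"
  shows "create c (create a f) S = - create a (create c f) S"
proof (cases "a = c \<or> a \<notin> S \<or> c \<notin> S")
  case True
  then show ?thesis by (auto simp: create_def)
next
  case False
  have "finite S" using finS assms by blast
  have key: "key a \<noteq> key c" using key_eq assms False by blast
  have 1: "S - {c} - {a} = S - {a} - {c}" by auto
  define p q where "p = rank c (S - {a})" and "q = rank a (S - {c})"
  have p: "rank c S = p + of_bool (key a < key c)"
    unfolding p_def by (rule rank_remove) (use False \<open>finite S\<close> in auto)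
  have q: "rank a S = q + of_bool (key c < key a)"
    unfolding q_def by (rule rank_remove) (use False \<open>finite S\<close> in auto)
  have "create c (create a f) S = (-1) ^ rank c S * ((-1) ^ q * f (S - {a} - {c}))"
    using False by (simp add: create_def q_def 1)
  moreover have "create a (create c f) S = (-1) ^ rank a S * ((-1) ^ p * f (S - {a} - {c}))"
    using False by (auto simp: create_def p_def)
  ultimately show ?thesis using key unfolding p q by (cases "key a < key c") auto
qed

text \<open>This compares the coefficients of \<open>f S\<close> on both sides of
  \<open>wick\<close>. By convexity every element outside the block of \<open>b\<close> lies below
  all of the block or above all of it, so it contributes one common sign \<open>(-1) ^ M\<close>,
  and an alternating sum inside the block remains.\<close>

lemma wick_basis:
  assumes S: "S \<subseteq> H" and b: "b \<in> H"
  shows "(if b \<notin> S then (-1) ^ rank b S * of_bool (even_blocks (insert b S)) else 0) =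
    (\<Sum>c\<in>S. turn b c * (-1) ^ rank c S * of_bool (even_blocks (S - {c})))"
proof -
  define B where "B = {h\<in>S. blk h = blk b}"
  define R where "R = {h\<in>S. blk h \<noteq> blk b}"
  have finS: "finite S" "finite B" "finite R" using finS[OF S] by (auto simp: B_def R_def)
  \<comment> \<open>Removing an element of \<open>B\<close> and adding a missing \<open>b\<close>
    both flip the parity of this one block only, so \<open>e\<close> is the evenness condition on
    either side.\<close>
  define e where "e \<longleftrightarrow> (\<forall>v. v \<noteq> blk b \<longrightarrow> even (card {h\<in>S. blk h = v})) \<and> odd (card B)"
  define M where "M = rank b R"
  have ev_rem: "even_blocks (S - {c}) \<longleftrightarrow> e" if "c \<in> B" for c
  proof -
    have "{h \<in> S - {c}. blk h = v} = (if v = blk b then B - {c} else {h \<in> S. blk h = v})" for v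
      using that by (auto simp: B_def)
    moreover have "odd (card B) \<longleftrightarrow> even (card (B - {c}))"
      using card.remove[OF finS(2) that] by simp
    ultimately show ?thesis unfolding even_blocks_def e_def by auto
  qed
  have ev_ins: "even_blocks (insert b S) \<longleftrightarrow> e" if "b \<notin> S"
  proof -
    have "{h \<in> insert b S. blk h = v} = (if v = blk b then insert b B else {h \<in> S. blk h = v})" for v
      by (auto simp: B_def)
    moreover have "card (insert b B) = Suc (card B)" using that finS by (simp add: B_def)
    ultimately show ?thesis unfolding even_blocks_def e_def by auto
  qed
  have rank_split: "rank c S = rank c B + rank c R" for c
  proof -
    have "{h\<in>S. key h < key c} = {h\<in>B. key h < key c} \<union> {h\<in>R. key h < key c}"
      by (auto simp: B_def R_def)
    moreover have "{h\<in>B. key h < key c} \<inter> {h\<in>R. key h < key c} = {}"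
      by (auto simp: B_def R_def)
    ultimately show ?thesis using finS by (simp add: rank_def card_Un_disjoint)
  qed
  have rank_R: "rank c R = M" if c: "c \<in> B" for c
  proof -
    have "key h < key c \<longleftrightarrow> key h < key b" if "h \<in> R" for h
    proof -
      have mem: "h \<in> H" "c \<in> H" "blk c = blk b" "blk h \<noteq> blk b"
        using that c S by (auto simp: R_def B_def)
      then have "key h \<noteq> key c" "key h \<noteq> key b" using key_eq b by metis+
      then show ?thesis
        using blk_convex[of b h c] blk_convex[of c h b] mem b by (metis linorder_neqE_nat)
    qed
    then show ?thesis unfolding M_def rank_def by (auto intro!: arg_cong[of _ _ card])
  qed
  \<comment> \<open>\<open>turn b\<close> is -1 below \<open>b\<close>, 0 at \<open>b\<close> and 1
    above it: hence the full alternating sum, minus twice its part below \<open>b\<close>, minus the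
    term of \<open>b\<close> if present. For odd \<open>card B\<close> the value is
    \<open>(-1) ^ rank b B\<close> if \<open>b\<close> is missing and 0 if it is present.\<close>
  have alt: "(\<Sum>c\<in>B. turn b c * (-1) ^ rank c B) = (if odd (card B) then 1 else 0)
      - 2 * (if odd (rank b B) then 1 else 0) - (if b \<in> S then (-1) ^ rank b B else 0)"
  proof -
    define Lo where "Lo = {c\<in>B. key c < key b}"
    define Hi where "Hi = {c\<in>B. key b < key c}"
    have BH: "B \<subseteq> H" using S by (auto simp: B_def)
    have fin: "finite Lo" "finite Hi" using finS by (auto simp: Lo_def Hi_def)
    have B_eq: "B = Lo \<union> Hi \<union> ({b} \<inter> S)"
    proof -
      have "key c < key b \<or> key b < key c \<or> c = b" if "c \<in> B" for c
        using key_eq[OF _ b, of c] that BH by auto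
      then show ?thesis by (auto simp: Lo_def Hi_def B_def)
    qed
    have disj: "Lo \<inter> Hi = {}" "(Lo \<union> Hi) \<inter> ({b} \<inter> S) = {}" by (auto simp: Lo_def Hi_def)
    have split: "sum g B = sum g Lo + sum g Hi + (if b \<in> S then g b else 0)" for g :: "'h \<Rightarrow> complex"
    proof -
      have "sum g B = sum g (Lo \<union> Hi) + sum g ({b} \<inter> S)"
        by (subst B_eq, rule sum.union_disjoint) (use fin disj in auto)
      also have "sum g (Lo \<union> Hi) = sum g Lo + sum g Hi"
        by (rule sum.union_disjoint) (use fin disj in auto)
      finally show ?thesis by auto
    qed
    have tot: "(\<Sum>c\<in>B. (-1) ^ rank c B) = (if odd (card B) then 1 else (0::complex))"
      unfolding rank_def using alternating_sum_rank finS(2) key_inj BH inj_on_subset by blast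
    have lo: "(\<Sum>c\<in>Lo. (-1) ^ rank c B) = (if odd (rank b B) then 1 else (0::complex))"
    proof -
      have "(\<Sum>c\<in>Lo. (-1) ^ rank c B) = (\<Sum>c\<in>Lo. (-1) ^ card {h\<in>Lo. key h < key c} :: complex)"
        unfolding rank_def by (intro sum.cong refl arg_cong[of _ _ "\<lambda>S. (-1) ^ card S"]) (auto simp: Lo_def)
      also have "\<dots> = (if odd (card Lo) then 1 else 0)"
        by (rule alternating_sum_rank[OF fin(1)], rule inj_on_subset[OF key_inj]) (use BH in \<open>auto simp: Lo_def\<close>)
      finally show ?thesis by (simp add: Lo_def rank_def)
    qed
    have tlo: "(\<Sum>c\<in>Lo. turn b c * (-1) ^ rank c B) = - (\<Sum>c\<in>Lo. (-1) ^ rank c B)"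
      unfolding sum_negf[symmetric] by (rule sum.cong) (auto simp: turn_def Lo_def B_def)
    have thi: "(\<Sum>c\<in>Hi. turn b c * (-1) ^ rank c B) = (\<Sum>c\<in>Hi. (-1) ^ rank c B)"
      by (rule sum.cong) (auto simp: turn_def Hi_def B_def)
    have "(\<Sum>c\<in>B. turn b c * (-1) ^ rank c B) =
        - (\<Sum>c\<in>Lo. (-1) ^ rank c B) + (\<Sum>c\<in>Hi. (-1) ^ rank c B)"
      unfolding split[of "\<lambda>c. turn b c * (-1) ^ rank c B"] tlo thi by (simp add: turn_def)
    then show ?thesis using split[of "\<lambda>c. (-1) ^ rank c B"] tot lo by auto
  qed
  have "(\<Sum>c\<in>S. turn b c * (-1) ^ rank c S * of_bool (even_blocks (S - {c}))) =
      (\<Sum>c\<in>B. turn b c * (-1) ^ rank c S * of_bool (even_blocks (S - {c})))"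
    by (rule sum.mono_neutral_right) (use finS in \<open>auto simp: B_def turn_def\<close>)
  also have "\<dots> = (\<Sum>c\<in>B. turn b c * (-1) ^ rank c B) * (-1) ^ M * of_bool e"
    unfolding sum_distrib_right by (intro sum.cong refl) (simp add: rank_split rank_R ev_rem power_add)
  also have "\<dots> = (if b \<notin> S then (-1) ^ rank b S * of_bool (even_blocks (insert b S)) else 0)"
    unfolding alt using ev_ins by (auto simp: rank_split M_def power_add e_def)
  finally show ?thesis ..
qed

lemma bracket_cong: "(\<And>S. S \<subseteq> H \<Longrightarrow> f S = g S) \<Longrightarrow> bracket f = bracket g"
  unfolding bracket_def by (intro sum.cong) auto

lemma bracket_create:
  assumes "b \<in> H"
  shows "bracket (create b f) =
    (\<Sum>S\<in>Pow H. (if b \<notin> S then (-1) ^ rank b S * of_bool (even_blocks (insert b S)) else 0) * f S)"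
proof -
  have "bracket (create b f) = (\<Sum>S\<in>{S\<in>Pow H. b \<in> S}. of_bool (even_blocks S) * create b f S)"
    unfolding bracket_def
    by (rule sum.mono_neutral_right) (use fin in \<open>auto simp: create_def\<close>)
  also have "\<dots> = (\<Sum>S\<in>{S\<in>Pow H. b \<notin> S}. (-1) ^ rank b S * of_bool (even_blocks (insert b S)) * f S)"
    by (rule sum.reindex_bij_witness[of _ "insert b" "\<lambda>S. S - {b}"])
      (use assms in \<open>auto simp: create_def insert_absorb\<close>)
  also have "\<dots> = (\<Sum>S\<in>Pow H. (if b \<notin> S then (-1) ^ rank b S * of_bool (even_blocks (insert b S)) else 0) * f S)"
    by (rule sum.mono_neutral_cong_left) (use fin in auto)
  finally show ?thesis .
qed

lemma bracket_annih:
  assumes "c \<in> H"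
  shows "bracket (annih c f) =
    (\<Sum>S\<in>Pow H. (if c \<in> S then (-1) ^ rank c S * of_bool (even_blocks (S - {c})) else 0) * f S)"
proof -
  have "bracket (annih c f) = (\<Sum>S\<in>{S\<in>Pow H. c \<notin> S}. of_bool (even_blocks S) * annih c f S)"
    unfolding bracket_def
    by (rule sum.mono_neutral_right) (use fin in \<open>auto simp: annih_def\<close>)
  also have "\<dots> = (\<Sum>S\<in>{S\<in>Pow H. c \<in> S}. (-1) ^ rank c S * of_bool (even_blocks (S - {c})) * f S)"
    by (rule sum.reindex_bij_witness[of _ "\<lambda>S. S - {c}" "insert c"])
      (use assms in \<open>auto simp: annih_def insert_absorb\<close>)
  also have "\<dots> = (\<Sum>S\<in>Pow H. (if c \<in> S then (-1) ^ rank c S * of_bool (even_blocks (S - {c})) else 0) * f S)"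
    by (rule sum.mono_neutral_cong_left) (use fin in auto)
  finally show ?thesis .
qed

text \<open>Row expansion of the Pfaffian of \<open>turn\<close> along \<open>b\<close>.\<close>

lemma wick:
  assumes "b \<in> H"
  shows "bracket (create b f) = (\<Sum>c\<in>H. turn b c * bracket (annih c f))"
proof -
  have "(\<Sum>c\<in>H. turn b c * bracket (annih c f)) =
      (\<Sum>c\<in>H. \<Sum>S\<in>Pow H. (if c \<in> S then turn b c * (-1) ^ rank c S * of_bool (even_blocks (S - {c})) else 0) * f S)"
    by (intro sum.cong refl) (auto simp: bracket_annih sum_distrib_left intro!: sum.cong)
  also have "\<dots> = (\<Sum>S\<in>Pow H. \<Sum>c\<in>H. (if c \<in> S then turn b c * (-1) ^ rank c S * of_bool (even_blocks (S - {c})) else 0) * f S)"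
    by (rule sum.swap)
  also have "\<dots> = (\<Sum>S\<in>Pow H. (\<Sum>c\<in>S. turn b c * (-1) ^ rank c S * of_bool (even_blocks (S - {c}))) * f S)"
  proof (intro sum.cong refl)
    fix S assume "S \<in> Pow H"
    then have "H \<inter> S = S" by auto
    then show "(\<Sum>c\<in>H. (if c \<in> S then turn b c * (-1) ^ rank c S * of_bool (even_blocks (S - {c})) else 0) * f S) =
        (\<Sum>c\<in>S. turn b c * (-1) ^ rank c S * of_bool (even_blocks (S - {c}))) * f S"
      using fin by (simp add: sum_distrib_right[symmetric] sum.inter_restrict[symmetric])
  qed
  also have "\<dots> = bracket (create b f)"
    unfolding bracket_create[OF assms] by (intro sum.cong refl) (use wick_basis[OF _ assms] in auto)
  finally show ?thesis ..
qed

lemma bracket_sub: "bracket (\<lambda>S. f S - g S) = bracket f - bracket g"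
  by (simp add: bracket_def right_diff_distrib sum_subtractf)

lemma bracket_cmult: "bracket (\<lambda>S. k * f S) = k * bracket f"
  by (simp add: bracket_def sum_distrib_left mult_ac)

lemma create_cmult: "create a (\<lambda>S. k * f S) = (\<lambda>S. k * create a f S)"
  by (auto simp: create_def)

section \<open>The Grassmann exponential of the edge matching\<close>

definition lower :: "'h set" where "lower = {a. key a < key (bar a)}"

text \<open>The chord whose lower end comes first has to be the first argument, so at most one of
  \<open>interleave a b\<close> and \<open>interleave b a\<close> is -1, and
  \<open>chord_sign\<close> counts each crossing pair of chords once. It is the usual sign of a
  perfect matching in a Pfaffian.\<close>

definition interleave :: "'h \<Rightarrow> 'h \<Rightarrow> complex" where
  "interleave a b = (if key a < key b \<and> key b < key (bar a) \<and> key (bar a) < key (bar b) then -1 else 1)"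

definition chord_sign :: "'h set \<Rightarrow> complex" where
  "chord_sign S = (\<Prod>a\<in>S \<inter> lower. \<Prod>b\<in>S \<inter> lower. interleave a b)"

text \<open>The degree \<open>n\<close> part of the Grassmann exponential of the edge matching.\<close>

definition matched :: "nat \<Rightarrow> 'h set \<Rightarrow> complex" where
  "matched n S = (if S \<subseteq> H \<and> bar ` S \<subseteq> S \<and> card S = 2 * n
     then chord_sign S * (\<Prod>a\<in>S \<inter> lower. x a) else 0)"

lemma interleave_self [simp]: "interleave a a = 1"
  by (simp add: interleave_def)

lemma lower_bar: "a \<in> H \<Longrightarrow> bar a \<in> lower \<longleftrightarrow> a \<notin> lower"
  using key_eq[of a "bar a"] bar_in[of a] bar_ne[of a] by (auto simp: lower_def bar_bar)

lemma minus_one_power_rank: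
  assumes "finite S"
  shows "(\<Prod>h\<in>S. if key h < key c then -1 else 1) = (-1 :: complex) ^ rank c S"
proof -
  have "(\<Prod>h\<in>S. if key h < key c then -1 else (1 :: complex)) = (\<Prod>h\<in>{h\<in>S. key h < key c}. -1)"
    by (rule prod.mono_neutral_cong_right) (use assms in auto)
  then show ?thesis by (simp add: rank_def)
qed

lemma prod_lower_pairs:
  assumes "T \<subseteq> H" "bar ` T \<subseteq> T"
  shows "(\<Prod>h\<in>T. g h :: complex) = (\<Prod>a\<in>T \<inter> lower. g a * g (bar a))"
proof -
  have "finite T" using assms finS by blast
  have "(\<Prod>h\<in>T. g h) = (\<Prod>h\<in>T \<inter> lower. g h) * (\<Prod>h\<in>T - lower. g h)"
    using \<open>finite T\<close> by (simp add: prod.Int_Diff)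
  also have "(\<Prod>h\<in>T - lower. g h) = (\<Prod>a\<in>T \<inter> lower. g (bar a))"
    by (rule prod.reindex_bij_witness[of _ bar bar]) (use assms lower_bar bar_bar in auto)
  finally show ?thesis by (simp add: prod.distrib)
qed

text \<open>The new chord interleaves an old one exactly when one of the two ends of the old chord
  lies between \<open>c\<close> and \<open>bar c\<close>. Lying between them means being below
  exactly one of them, so over all of \<open>T\<close> the parity is that of the sum of the two
  ranks.\<close>

lemma matched_insert_lower:
  assumes T: "T \<subseteq> H" "bar ` T \<subseteq> T" and c: "c \<in> H" "c \<notin> T" "c \<in> lower"
  defines "T' \<equiv> insert c (insert (bar c) T)"
  shows "matched (Suc n) T' = (-1) ^ (rank c T + rank (bar c) T) * x c * matched n T"
proof -
  have "finite T" using T finS by blast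
  have cb: "bar c \<notin> T" using T(2) c bar_bar by force
  have T': "T' \<subseteq> H" "bar ` T' \<subseteq> T'" using T c bar_in bar_bar by (auto simp: T'_def)
  have card: "card T' = 2 + card T" using \<open>finite T\<close> c cb bar_ne[of c] by (simp add: T'_def)
  have low: "T' \<inter> lower = insert c (T \<inter> lower)" using c lower_bar by (auto simp: T'_def)
  have pair: "interleave c a * interleave a c =
      (if key a < key c then -1 else 1) * (if key a < key (bar c) then -1 else 1) *
      ((if key (bar a) < key c then -1 else 1) * (if key (bar a) < key (bar c) then -1 else 1))"
    if a: "a \<in> T \<inter> lower" for a
  proof -
    have "a \<in> H" "bar a \<in> T" "a \<noteq> c" "a \<noteq> bar c"
      using a T c cb by auto
    then have "bar a \<in> H" "bar c \<in> H" "bar a \<noteq> c" "bar a \<noteq> bar c"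
      using T c cb bar_in by auto
    then have "key a \<noteq> key c" "key a \<noteq> key (bar c)" "key (bar a) \<noteq> key c" "key (bar a) \<noteq> key (bar c)"
      using key_eq c \<open>a \<in> H\<close> \<open>a \<noteq> c\<close> \<open>a \<noteq> bar c\<close> by auto
    then show ?thesis using a c(3) by (auto simp: interleave_def lower_def)
  qed
  have "chord_sign T' = chord_sign T * (\<Prod>a\<in>T \<inter> lower. interleave c a * interleave a c)"
    unfolding chord_sign_def low using \<open>finite T\<close> c by (simp add: prod.distrib)
  also have "(\<Prod>a\<in>T \<inter> lower. interleave c a * interleave a c) =
      (\<Prod>h\<in>T. (if key h < key c then -1 else 1) * (if key h < key (bar c) then -1 else 1))"
    using pair by (subst prod_lower_pairs[OF T]) simp
  also have "\<dots> = (-1) ^ (rank c T + rank (bar c) T)"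
    using \<open>finite T\<close> by (simp add: prod.distrib minus_one_power_rank power_add)
  finally have "chord_sign T' = chord_sign T * (-1) ^ (rank c T + rank (bar c) T)" .
  then show ?thesis
    using T T' card low c \<open>finite T\<close> by (simp add: matched_def mult_ac)
qed

lemma matched_insert:
  assumes T: "T \<subseteq> H" "bar ` T \<subseteq> T" and c: "c \<in> H" "c \<notin> T"
  shows "matched (Suc n) (insert c (insert (bar c) T)) = (-1) ^ (rank c T + rank (bar c) T) * x c * matched n T"
proof (cases "c \<in> lower")
  case True
  then show ?thesis using matched_insert_lower assms by blast
next
  case False
  have "bar c \<notin> T" using T(2) c bar_bar by force
  then have "matched (Suc n) (insert (bar c) (insert c T)) =
      (-1) ^ (rank (bar c) T + rank c T) * x c * matched n T"
    using matched_insert_lower[of T "bar c" n] T c False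
    by (simp only: lower_bar bar_in bar_bar x_bar simp_thms)
  then show ?thesis by (simp only: insert_commute[of c "bar c"] add.commute[of "rank c T"])
qed

text \<open>This differentiates the exponential of a quadratic form: the chord at \<open>c\<close>
  loses the end \<open>c\<close> and keeps \<open>bar c\<close>. The ranks in
  \<open>matched_insert\<close> cancel against those of \<open>annih\<close> and
  \<open>create\<close>, except that the rank of \<open>c\<close> also sees \<open>bar c\<close> if
  that lies below, which gives \<open>dirsgn c\<close>.\<close>

lemma annih_matched:
  assumes S: "S \<subseteq> H" and c: "c \<in> H"
  shows "annih c (matched (Suc n)) S = dirsgn c * x c * create (bar c) (matched n) S"
proof (cases "c \<in> S")
  case True
  have "c \<in> S - {bar c}" using True bar_ne[OF c] by simp
  then have "\<not> bar ` (S - {bar c}) \<subseteq> S - {bar c}" by blast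
  then show ?thesis using True by (auto simp: annih_def create_def matched_def)
next
  case False
  have "finite S" using S finS by blast
  show ?thesis
  proof (cases "bar c \<in> S")
    case cb: False
    then have "\<not> bar ` (insert c S) \<subseteq> insert c S" using bar_ne[OF c] by auto
    then show ?thesis using cb False by (auto simp: annih_def create_def matched_def)
  next
    case cb: True
    define T where "T = S - {bar c}"
    have S_eq: "S = insert (bar c) T" using cb by (auto simp: T_def)
    have TH: "T \<subseteq> H" "c \<notin> T" "bar c \<notin> T" "finite T" using S False \<open>finite S\<close> by (auto simp: T_def)
    show ?thesis
    proof (cases "bar ` T \<subseteq> T")
      case True
      have "rank c S = rank c T + of_bool (key (bar c) < key c)"
        unfolding S_eq using rank_insert TH by blast
      moreover have "key c \<noteq> key (bar c)" using key_eq c bar_in bar_ne by metis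
      moreover have "rank (bar c) S = rank (bar c) T" by (simp add: S_eq)
      ultimately show ?thesis
        using matched_insert[OF TH(1) True c TH(2), of n] False cb
        by (auto simp: annih_def create_def T_def[symmetric] S_eq[symmetric] dirsgn_def power_add)
    next
      case nc: False
      have "\<not> bar ` (insert c S) \<subseteq> insert c S"
      proof
        assume *: "bar ` (insert c S) \<subseteq> insert c S"
        have "bar h \<in> T" if h: "h \<in> T" for h
        proof -
          have "h \<in> H" "h \<noteq> c" "h \<noteq> bar c" using h TH by auto
          then have "bar h \<noteq> c" "bar h \<noteq> bar c" using bar_bar c by metis+
          moreover have "bar h \<in> insert c S" using * h S_eq by auto
          ultimately show ?thesis by (simp add: T_def)
        qed
        then show False using nc by auto
      qed
      then show ?thesis using nc False cb by (auto simp: annih_def create_def matched_def T_def[symmetric])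
    qed
  qed
qed

lemma annih_matched_0: "annih c (matched 0) S = 0"
proof -
  have "matched 0 (insert c S) = 0"
    using finS[of "insert c S"] by (auto simp: matched_def)
  then show ?thesis by (simp add: annih_def)
qed

section \<open>Two-point functions and Euler's identity\<close>

definition part :: "nat \<Rightarrow> complex" where "part n = bracket (matched n)"

text \<open>The unnormalised two-point function: two marked half-edges in addition to
  \<open>n\<close> chords.\<close>

definition corr :: "nat \<Rightarrow> 'h \<Rightarrow> 'h \<Rightarrow> complex" where
  "corr n b a = bracket (create b (create a (matched n)))"

lemma corr_wick:
  assumes "a \<in> H" "b \<in> H"
  shows "corr n b a = turn b a * part n - (\<Sum>c\<in>H. turn b c * bracket (create a (annih c (matched n))))"
proof -
  have "corr n b a = (\<Sum>c\<in>H. turn b c * bracket (annih c (create a (matched n))))"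
    unfolding corr_def by (rule wick[OF assms(2)])
  also have "\<dots> = (\<Sum>c\<in>H. turn b c * (of_bool (a = c) * part n - bracket (create a (annih c (matched n)))))"
  proof (intro sum.cong refl arg_cong[of _ _ "(*) _"])
    fix c assume "c \<in> H"
    then have "bracket (annih c (create a (matched n))) =
        bracket (\<lambda>S. of_bool (a = c) * matched n S - create a (annih c (matched n)) S)"
      by (intro bracket_cong annih_create assms)
    then show "bracket (annih c (create a (matched n))) =
        of_bool (a = c) * part n - bracket (create a (annih c (matched n)))"
      by (simp only: bracket_sub bracket_cmult part_def)
  qed
  also have "\<dots> = (\<Sum>c\<in>H. if c = a then turn b c * part n else 0) -
      (\<Sum>c\<in>H. turn b c * bracket (create a (annih c (matched n))))"
    unfolding sum_subtractf[symmetric] by (intro sum.cong refl) (auto simp: algebra_simps)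
  finally show ?thesis using assms fin by simp
qed

lemma corr_0:
  assumes "a \<in> H" "b \<in> H"
  shows "corr 0 b a = turn b a * part 0"
proof -
  have "create a (annih c (matched 0)) = (\<lambda>S. 0)" for c
    by (auto simp: create_def annih_matched_0)
  then show ?thesis using corr_wick[OF assms] by (simp add: bracket_def)
qed

lemma create_annih_matched:
  assumes "a \<in> H" "c \<in> H"
  shows "bracket (create a (annih c (matched (Suc n)))) =
    dirsgn c * x c * bracket (create a (create (bar c) (matched n)))"
proof -
  have "bracket (create a (annih c (matched (Suc n)))) =
      bracket (create a (\<lambda>S. (dirsgn c * x c) * create (bar c) (matched n) S))"
    by (rule bracket_cong) (use assms annih_matched in \<open>auto simp: create_def subset_iff\<close>)
  then show ?thesis by (simp only: create_cmult bracket_cmult)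
qed

text \<open>Contracting \<open>b\<close> with \<open>c\<close> breaks the chord at \<open>c\<close>,
  and its other half \<open>bar c\<close> becomes the marked half-edge. Exchanging \<open>a\<close>
  with \<open>bar c\<close> absorbs the minus sign of \<open>corr_wick\<close>.\<close>

lemma corr_Suc:
  assumes "a \<in> H" "b \<in> H"
  shows "corr (Suc n) b a = turn b a * part (Suc n) + (\<Sum>c\<in>H. turn b c * dirsgn c * x c * corr n (bar c) a)"
proof -
  have "bracket (create a (annih c (matched (Suc n)))) = - dirsgn c * x c * corr n (bar c) a"
    if c: "c \<in> H" for c
  proof -
    have "bracket (create a (create (bar c) (matched n))) =
        bracket (\<lambda>S. (-1) * create (bar c) (create a (matched n)) S)"
      by (rule bracket_cong) (simp add: create_create[OF _ bar_in[OF c] assms(1)])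
    then show ?thesis
      unfolding create_annih_matched[OF assms(1) c] bracket_cmult corr_def by simp
  qed
  then show ?thesis using corr_wick[OF assms] by (simp add: sum_negf mult_ac)
qed

lemma part_0: "part 0 = 1"
proof -
  have "part 0 = (\<Sum>S\<in>{{}}. of_bool (even_blocks S) * matched 0 S)"
    unfolding part_def bracket_def
    by (rule sum.mono_neutral_right) (use fin finS in \<open>auto simp: matched_def\<close>)
  then show ?thesis by (simp add: matched_def chord_sign_def even_blocks_def)
qed

text \<open>Euler's identity for homogeneous functions: \<open>create a\<close> after
  \<open>annih a\<close> keeps exactly the sets containing \<open>a\<close>, so the sum over
  \<open>a\<close> multiplies by the cardinality, which is \<open>2 * Suc n\<close> on the
  support.\<close>

lemma part_corr:
  "2 * of_nat (Suc n) * part (Suc n) = (\<Sum>a\<in>H. dirsgn a * x a * corr n a (bar a))"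
proof -
  have "(\<Sum>a\<in>H. dirsgn a * x a * corr n a (bar a)) =
      (\<Sum>a\<in>H. bracket (create a (annih a (matched (Suc n)))))"
    by (intro sum.cong refl) (simp add: create_annih_matched corr_def)
  also have "\<dots> = (\<Sum>a\<in>H. \<Sum>S\<in>Pow H. of_bool (a \<in> S) * (of_bool (even_blocks S) * matched (Suc n) S))"
    unfolding bracket_def
    by (intro sum.cong refl) (auto simp: create_def annih_def insert_absorb mult.assoc[symmetric] power_add[symmetric])
  also have "\<dots> = (\<Sum>S\<in>Pow H. \<Sum>a\<in>H. of_bool (a \<in> S) * (of_bool (even_blocks S) * matched (Suc n) S))"
    by (rule sum.swap)
  also have "\<dots> = (\<Sum>S\<in>Pow H. 2 * of_nat (Suc n) * (of_bool (even_blocks S) * matched (Suc n) S))"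
  proof (intro sum.cong refl)
    fix S assume S: "S \<in> Pow H"
    then have "(\<Sum>a\<in>H. of_bool (a \<in> S)) = (of_nat (card S) :: complex)"
      using fin by (simp add: of_bool_def sum.inter_restrict[symmetric] Int_absorb1)
    then show "(\<Sum>a\<in>H. of_bool (a \<in> S) * (of_bool (even_blocks S) * matched (Suc n) S)) =
        2 * of_nat (Suc n) * (of_bool (even_blocks S) * matched (Suc n) S)"
      unfolding sum_distrib_right[symmetric] by (auto simp: matched_def)
  qed
  finally show ?thesis by (simp add: part_def bracket_def sum_distrib_left)
qed

end

section \<open>Segments and turning angles in the plane\<close>

text \<open>Breaking ties towards the negative real axis makes \<open>upward z\<close> equivalent to \<open>0 < Arg z\<close>.\<close>

definition upward :: "complex \<Rightarrow> bool" where
  "upward z \<longleftrightarrow> 0 < Im z \<or> (Im z = 0 \<and> Re z < 0)"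

definition cross_prod :: "complex \<Rightarrow> complex \<Rightarrow> real" where
  "cross_prod z w = Re z * Im w - Im z * Re w"

lemma upward_add: "upward z \<Longrightarrow> upward w \<Longrightarrow> upward (z + w)"
  by (auto simp: upward_def)

lemma upward_scaleR: "0 < t \<Longrightarrow> upward (t *\<^sub>R z) \<longleftrightarrow> upward z"
  by (auto simp: upward_def zero_less_mult_iff mult_less_0_iff)

lemma upward_0 [simp]: "\<not> upward 0"
  by (simp add: upward_def)

lemma upward_minus: "z \<noteq> 0 \<Longrightarrow> upward (- z) \<longleftrightarrow> \<not> upward z"
  by (auto simp: upward_def complex_eq_iff)

lemma upward_trans: "upward (b - a) \<Longrightarrow> upward (c - b) \<Longrightarrow> upward (c - a)"
  using upward_add[of "b - a" "c - b"] by simp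

lemma upward_asym: "upward (b - a) \<Longrightarrow> \<not> upward (a - b)"
  by (auto simp: upward_def)

lemma upward_linear: "a \<noteq> b \<Longrightarrow> upward (b - a) \<or> upward (a - b)"
  by (auto simp: upward_def complex_eq_iff)

lemma upward_iff_Arg: "upward z \<longleftrightarrow> 0 < Arg z"
proof (cases "z = 0")
  case True
  then show ?thesis by (simp add: Arg_zero)
next
  case False
  have re: "Re z = norm z * cos (Arg z)" and im: "Im z = norm z * sin (Arg z)"
    using False by (simp_all add: cos_Arg sin_Arg)
  have pos: "0 < norm z" using False by simp
  consider "- pi < Arg z" "Arg z < 0" | "Arg z = 0" | "0 < Arg z" "Arg z < pi" | "Arg z = pi"
    using Arg_bounded[of z] by linarith
  then show ?thesis
  proof cases
    case 1
    then have "sin (Arg z) < 0" using sin_gt_zero[of "- Arg z"] by simp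
    then have "Im z < 0" using im pos by (simp add: mult_pos_neg)
    then show ?thesis using 1 by (simp add: upward_def)
  next
    case 2
    then show ?thesis using re im by (simp add: upward_def)
  next
    case 3
    then have "Im z > 0" using im pos sin_gt_zero by simp
    then show ?thesis using 3 by (simp add: upward_def)
  next
    case 4
    then show ?thesis using re im pos by (simp add: upward_def)
  qed
qed

lemma cross_prod_Arg: "cross_prod z w = norm z * norm w * sin (Arg w - Arg z)"
proof (cases "z = 0 \<or> w = 0")
  case True
  then show ?thesis by (auto simp: cross_prod_def)
next
  case False
  have eq: "Re u = norm u * cos (Arg u)" "Im u = norm u * sin (Arg u)" if "u \<noteq> 0" for u
    using that by (simp_all add: cos_Arg sin_Arg)
  have "cross_prod z w = (norm z * cos (Arg z)) * (norm w * sin (Arg w)) - (norm z * sin (Arg z)) * (norm w * cos (Arg w))"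
    using False eq unfolding cross_prod_def by metis
  then show ?thesis by (simp add: sin_diff algebra_simps)
qed

text \<open>Both arguments lie in the same half-open interval of length \<pi>, so their difference
  is in the range where the sine has the sign of its argument.\<close>

lemma Arg_less_iff_cross_prod:
  assumes "z \<noteq> 0" "w \<noteq> 0" "upward z = upward w"
  shows "Arg z < Arg w \<longleftrightarrow> 0 < cross_prod z w"
proof -
  have *: "- pi < Arg w - Arg z" "Arg w - Arg z < pi"
    using assms Arg_bounded[of z] Arg_bounded[of w] unfolding upward_iff_Arg by linarith+
  have "0 < cross_prod z w \<longleftrightarrow> 0 < sin (Arg w - Arg z)"
  proof -
    have "0 < norm z * norm w" using assms by simp
    then show ?thesis unfolding cross_prod_Arg by (metis mult_pos_pos zero_less_mult_pos)
  qed
  also have "\<dots> \<longleftrightarrow> 0 < Arg w - Arg z"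
  proof
    assume s: "0 < sin (Arg w - Arg z)"
    show "0 < Arg w - Arg z"
    proof (rule ccontr)
      assume "\<not> ?thesis"
      then have "0 \<le> sin (- (Arg w - Arg z))" using * by (intro sin_ge_zero) auto
      then show False using s by (simp only: sin_minus)
    qed
  qed (use * sin_gt_zero in auto)
  finally show ?thesis by simp
qed

text \<open>\<open>Arg (z / w)\<close> is the difference of the arguments brought back to the
  principal range; each correction by 2\<pi> negates the exponential of the half angle.\<close>

lemma exp_half_Arg_divide:
  assumes "z \<noteq> 0" "w \<noteq> 0"
  shows "exp (\<i> * complex_of_real (Arg (z / w) / 2)) =
    (if - pi < Arg z - Arg w \<and> Arg z - Arg w \<le> pi then 1 else -1) *
    exp (\<i> * complex_of_real ((Arg z - Arg w) / 2))"
proof -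
  define d where "d = Arg z - Arg w"
  have d: "- 2 * pi < d" "d < 2 * pi"
    using Arg_bounded[of z] Arg_bounded[of w] by (simp_all add: d_def)
  have zw: "z / w = complex_of_real (norm (z / w)) * exp (\<i> * complex_of_real d)"
  proof -
    have "z / w = (complex_of_real (norm z) * exp (\<i> * complex_of_real (Arg z))) /
        (complex_of_real (norm w) * exp (\<i> * complex_of_real (Arg w)))"
      using assms Arg_eq by metis
    also have "\<dots> = complex_of_real (norm z / norm w) *
        (exp (\<i> * complex_of_real (Arg z)) / exp (\<i> * complex_of_real (Arg w)))"
      by simp
    finally have eq: "z / w = complex_of_real (norm z / norm w) *
        (exp (\<i> * complex_of_real (Arg z)) / exp (\<i> * complex_of_real (Arg w)))" .
    show ?thesis
      by (subst eq) (simp only: d_def norm_divide right_diff_distrib exp_diff of_real_diff)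
  qed
  have pos: "0 < norm (z / w)" using assms by simp
  have e2: "exp (\<i> * complex_of_real (d + 2 * pi)) = exp (\<i> * complex_of_real d)"
    "exp (\<i> * complex_of_real (d - 2 * pi)) = exp (\<i> * complex_of_real d)"
    by (simp_all add: distrib_left right_diff_distrib exp_add exp_diff mult.commute mult.left_commute)
  have h: "exp (\<i> * complex_of_real ((d + 2 * pi) / 2)) = - exp (\<i> * complex_of_real (d / 2))"
    "exp (\<i> * complex_of_real ((d - 2 * pi) / 2)) = - exp (\<i> * complex_of_real (d / 2))"
    by (simp_all add: add_divide_distrib diff_divide_distrib distrib_left right_diff_distrib exp_add exp_diff)
  consider "- pi < d" "d \<le> pi" | "pi < d" | "d \<le> - pi" by linarith
  then show ?thesis
  proof cases
    case 1
    then have "Arg (z / w) = d" using Arg_unique[OF zw[symmetric] pos] by simp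
    then show ?thesis using 1 by (simp add: d_def)
  next
    case 2
    have "Arg (z / w) = d - 2 * pi"
      by (rule Arg_unique[of "norm (z / w)"]) (use zw pos e2 2 d in auto)
    then show ?thesis using 2 h(2) by (simp add: d_def)
  next
    case 3
    have "Arg (z / w) = d + 2 * pi"
      by (rule Arg_unique[of "norm (z / w)"]) (use zw pos e2 3 d in auto)
    then show ?thesis using 3 h(1) pi_gt_zero by (simp add: d_def)
  qed
qed

text \<open>Here \<open>y\<close> points back along the incoming step. \<open>Arg (- y)\<close>
  differs from \<open>Arg y\<close> by \<pi>, with a sign depending on \<open>upward y\<close>, and
  so the range condition of \<open>exp_half_Arg_divide\<close> becomes a comparison of
  \<open>Arg z\<close> with \<open>Arg y\<close>. The remaining exponential is the
  coboundary.\<close>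

lemma exp_half_turn_angle:
  assumes "z \<noteq> 0" "y \<noteq> 0" "Arg z \<noteq> Arg y"
  shows "exp (\<i> * complex_of_real (Arg (z / (- y)) / 2)) =
    (if upward y then -1 else 1) * (if Arg y < Arg z then 1 else -1) *
    exp (\<i> * complex_of_real ((Arg z - Arg (- y)) / 2))"
proof -
  have "exp (\<i> * complex_of_real (Arg (z / (- y)) / 2)) =
    (if - pi < Arg z - Arg (- y) \<and> Arg z - Arg (- y) \<le> pi then 1 else -1) *
    exp (\<i> * complex_of_real ((Arg z - Arg (- y)) / 2))"
    by (rule exp_half_Arg_divide) (use assms in auto)
  moreover have "- pi < Arg z - Arg (- y) \<and> Arg z - Arg (- y) \<le> pi \<longleftrightarrow> (if upward y then Arg z < Arg y else Arg y < Arg z)"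
    using Arg_bounded[of z] Arg_bounded[of y] assms
    unfolding upward_iff_Arg Arg_minus[OF assms(2)] by auto
  ultimately show ?thesis using assms by auto
qed

lemma in_closed_segment_complex:
  "z \<in> closed_segment P Q \<longleftrightarrow> (\<exists>t\<ge>0. t \<le> 1 \<and> z = P + t *\<^sub>R (Q - P))" for P :: complex
  unfolding in_segment by (auto simp: algebra_simps)

lemma segment_upward:
  assumes "upward (Q - P)" "z \<in> closed_segment P Q"
  shows "z = P \<or> upward (z - P)" "z = Q \<or> upward (Q - z)"
proof -
  obtain t where t: "0 \<le> t" "t \<le> 1" "z = P + t *\<^sub>R (Q - P)"
    using assms(2) in_closed_segment_complex by auto
  show "z = P \<or> upward (z - P)"
    using t upward_scaleR[of t "Q - P"] assms(1) by (cases "t = 0") auto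
  have "Q - z = (1 - t) *\<^sub>R (Q - P)" using t by (simp add: algebra_simps)
  then show "z = Q \<or> upward (Q - z)"
    using t upward_scaleR[of "1 - t" "Q - P"] assms(1) by (cases "t = 1") auto
qed

lemma cross_prod_zero_scale:
  assumes "cross_prod A B = 0" "A \<noteq> 0"
  obtains t where "B = t *\<^sub>R A"
proof (cases "Re A = 0")
  case True
  then have "B = (Im B / Im A) *\<^sub>R A"
    using assms by (auto simp: cross_prod_def complex_eq_iff)
  then show ?thesis using that by blast
next
  case False
  then have "B = (Re B / Re A) *\<^sub>R A"
    using assms by (auto simp: cross_prod_def complex_eq_iff field_simps)
  then show ?thesis using that by blast
qed

lemma collinear_between:
  assumes "cross_prod (Q - P) (z - P) = 0" "upward (z - P)" "upward (Q - z)"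
  shows "z \<in> open_segment P Q"
proof -
  have up: "upward (Q - P)" using assms upward_trans by blast
  then have ne: "P \<noteq> Q" by auto
  obtain t where t: "z - P = t *\<^sub>R (Q - P)"
    using cross_prod_zero_scale[OF assms(1)] ne by (metis right_minus_eq)
  have "0 < t"
  proof (rule ccontr)
    assume "\<not> 0 < t"
    moreover have "t \<noteq> 0" using t assms(2) by auto
    ultimately have "upward ((- t) *\<^sub>R (Q - P))" using upward_scaleR[of "- t"] up by simp
    then have "upward (P - z)" using t by (metis minus_diff_eq scaleR_minus_left)
    then show False using assms(2) upward_asym by blast
  qed
  have Qz: "Q - z = (1 - t) *\<^sub>R (Q - P)" using t by (simp add: algebra_simps)
  have "t < 1"
  proof (rule ccontr)
    assume "\<not> t < 1"
    moreover have "t \<noteq> 1" using Qz assms(3) by auto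
    ultimately have "upward ((t - 1) *\<^sub>R (Q - P))" using upward_scaleR[of "t - 1"] up by simp
    moreover have "(t - 1) *\<^sub>R (Q - P) = z - Q" using Qz by (simp add: algebra_simps)
    ultimately show False using assms(3) upward_asym by metis
  qed
  have "z = (1 - t) *\<^sub>R P + t *\<^sub>R Q" using t by (simp add: algebra_simps)
  then show ?thesis using \<open>0 < t\<close> \<open>t < 1\<close> ne unfolding in_segment by blast
qed

text \<open>In the upward order both \<open>U\<close> and \<open>W\<close> lie between
  \<open>P\<close> and \<open>Q\<close>, so a point of the inner segment on the line through
  \<open>P\<close> and \<open>Q\<close> lies on the outer segment automatically. Only a change of
  side along the inner segment matters.\<close>

lemma nested_segments_meet_iff:
  assumes "upward (U - P)" "upward (W - U)" "upward (Q - W)"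
    and ne: "cross_prod (Q - P) (U - P) \<noteq> 0" "cross_prod (Q - P) (W - P) \<noteq> 0"
  shows "(\<exists>z. z \<in> closed_segment P Q \<and> z \<in> closed_segment U W) \<longleftrightarrow>
    cross_prod (Q - P) (U - P) * cross_prod (Q - P) (W - P) < 0"
proof -
  let ?D = "cross_prod (Q - P) (U - P)" and ?D' = "cross_prod (Q - P) (W - P)"
  have aff: "cross_prod (Q - P) (U + s *\<^sub>R (W - U) - P) = (1 - s) * ?D + s * ?D'" for s
    by (simp add: cross_prod_def algebra_simps)
  show ?thesis
  proof
    assume "\<exists>z. z \<in> closed_segment P Q \<and> z \<in> closed_segment U W"
    then obtain t s where t: "0 \<le> t" "t \<le> 1" and s: "0 \<le> s" "s \<le> 1"
      and z: "P + t *\<^sub>R (Q - P) = U + s *\<^sub>R (W - U)"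
      unfolding in_closed_segment_complex by metis
    have "cross_prod (Q - P) (P + t *\<^sub>R (Q - P) - P) = 0" by (simp add: cross_prod_def algebra_simps)
    then have eq: "(1 - s) * ?D + s * ?D' = 0" using aff[of s] z by simp
    show "?D * ?D' < 0"
    proof (rule ccontr)
      assume "\<not> ?thesis"
      then have "?D * ?D' > 0" using ne by (meson linorder_neqE_linordered_idom mult_eq_0_iff)
      then consider "?D > 0" "?D' > 0" | "?D < 0" "?D' < 0" by (auto simp: zero_less_mult_iff)
      then show False
      proof cases
        case 1
        then have "(1 - s) * ?D + s * ?D' > 0"
          using s by (cases "s = 0") (auto intro!: add_nonneg_pos)
        then show False using eq by simp
      next
        case 2
        then have "(1 - s) * ?D + s * ?D' < 0"
          using s by (cases "s = 0") (auto intro!: add_nonpos_neg mult_nonneg_nonpos mult_pos_neg)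
        then show False using eq by simp
      qed
    qed
  next
    assume neg: "?D * ?D' < 0"
    \<comment> \<open>The zero of the affine function \<open>aff\<close> along the inner
      segment.\<close>
    define s where "s = ?D / (?D - ?D')"
    have dne: "?D - ?D' \<noteq> 0" using neg by (metis eq_iff_diff_eq_0 not_square_less_zero)
    have "0 < s \<and> s < 1"
      using neg dne by (auto simp: s_def mult_less_0_iff field_simps)
    define z where "z = U + s *\<^sub>R (W - U)"
    have zUW: "z \<in> closed_segment U W"
      unfolding in_closed_segment_complex z_def using \<open>0 < s \<and> s < 1\<close> by (intro exI[of _ s]) auto
    have "(1 - s) * ?D + s * ?D' = ?D - s * (?D - ?D')" by (simp add: algebra_simps)
    also have "\<dots> = 0" using dne by (simp add: s_def)
    finally have "cross_prod (Q - P) (z - P) = 0" unfolding z_def aff .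
    moreover have "upward (z - P)" "upward (Q - z)"
      using segment_upward[OF assms(2) zUW] upward_trans assms(1,3) by blast+
    ultimately have "z \<in> open_segment P Q" by (rule collinear_between)
    then show "\<exists>z. z \<in> closed_segment P Q \<and> z \<in> closed_segment U W"
      using zUW by (auto simp: open_segment_def)
  qed
qed

text \<open>The shared levels run from \<open>U\<close> to \<open>Q\<close>. The first cross product
  compares the segments at \<open>U\<close>, the second at \<open>Q\<close> with the roles of the
  segments exchanged, so equal signs mean that the left-right order has changed in between.\<close>

lemma interleaved_segments_meet_iff:
  assumes "upward (U - P)" "upward (Q - U)" "upward (W - Q)"
    and ne: "cross_prod (Q - P) (U - P) \<noteq> 0" "cross_prod (W - U) (Q - U) \<noteq> 0"
  shows "(\<exists>z. z \<in> closed_segment P Q \<and> z \<in> closed_segment U W) \<longleftrightarrow>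
    0 < cross_prod (Q - P) (U - P) * cross_prod (W - U) (Q - U)"
proof -
  define A B C where "A = Q - P" and "B = W - U" and "C = Q - U"
  define D1 where "D1 = cross_prod (Q - P) (U - P)"
  define D2 where "D2 = cross_prod (W - U) (Q - U)"
  define \<Delta> where "\<Delta> = cross_prod A B"
  \<comment> \<open>Any three plane vectors satisfy the relation "\<open>A\<close> times
    cross(\<open>B\<close>, \<open>C\<close>) plus cyclic permutations is 0". Since
    \<open>U - P = A - C\<close>, \<open>D1\<close> is cross(\<open>C\<close>, \<open>A\<close>),
    and this is the imaginary part of the relation.\<close>
  have jac: "Im A * D2 + Im B * D1 + Im C * \<Delta> = 0"
    by (simp add: A_def B_def C_def D1_def D2_def \<Delta>_def cross_prod_def) algebra
  show ?thesis
  proof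
    assume "\<exists>z. z \<in> closed_segment P Q \<and> z \<in> closed_segment U W"
    then obtain t s where t: "0 \<le> t" "t \<le> 1" and s: "0 \<le> s" "s \<le> 1"
      and z: "P + t *\<^sub>R A = U + s *\<^sub>R B"
      unfolding in_closed_segment_complex A_def B_def by metis
    have "U - P = t *\<^sub>R A - s *\<^sub>R B" using z by (simp add: algebra_simps)
    then have "D1 = cross_prod A (t *\<^sub>R A - s *\<^sub>R B)" by (simp add: D1_def A_def)
    then have D1: "D1 = - (s * \<Delta>)" by (simp add: \<Delta>_def cross_prod_def algebra_simps)
    have "Q - U = (1 - t) *\<^sub>R A + s *\<^sub>R B" using z by (simp add: A_def algebra_simps)
    then have "D2 = cross_prod B ((1 - t) *\<^sub>R A + s *\<^sub>R B)" by (simp add: D2_def B_def)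
    then have D2: "D2 = - ((1 - t) * \<Delta>)" by (simp add: \<Delta>_def cross_prod_def algebra_simps)
    have "D1 * D2 = (s * (1 - t)) * (\<Delta> * \<Delta>)" unfolding D1 D2 by simp
    then have "0 \<le> D1 * D2" using s t by simp
    moreover have "D1 * D2 \<noteq> 0" using ne by (simp add: D1_def D2_def)
    ultimately show "0 < cross_prod (Q - P) (U - P) * cross_prod (W - U) (Q - U)"
      unfolding D1_def[symmetric] D2_def[symmetric] by linarith
  next
    assume "0 < cross_prod (Q - P) (U - P) * cross_prod (W - U) (Q - U)"
    then have pos: "0 < D1 * D2" by (simp add: D1_def D2_def)
    have Im_le: "0 \<le> Im (U - P)" "0 \<le> Im C" "0 \<le> Im (W - Q)"
      using assms(1-3) by (auto simp: upward_def C_def)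
    have ImA: "Im C \<le> Im A" and ImB: "Im C \<le> Im B" using Im_le by (auto simp: A_def B_def C_def)
    have "Im A \<noteq> 0"
      using ne(1) Im_le by (auto simp: A_def C_def cross_prod_def)
    then have ImA0: "0 < Im A" using ImA Im_le by linarith
    have "Im B \<noteq> 0"
      using ne(2) Im_le by (auto simp: B_def C_def cross_prod_def)
    then have ImB0: "0 < Im B" using ImB Im_le by linarith
    \<comment> \<open>By the Jacobi-type identity \<open>jac\<close>, \<open>\<Delta>\<close> has the sign opposite to \<open>D1\<close> and \<open>D2\<close> and dominates both.\<close>
    have main: "0 \<le> - d1 / \<delta> \<and> - d1 / \<delta> \<le> 1 \<and> 0 \<le> 1 + d2 / \<delta> \<and> 1 + d2 / \<delta> \<le> 1 \<and> \<delta> \<noteq> 0"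
      if d: "0 < d1" "0 < d2" and j: "Im A * d2 + Im B * d1 + Im C * \<delta> = 0" for d1 d2 \<delta> :: real
    proof -
      have p: "0 < Im A * d2" "0 < Im B * d1" using d ImA0 ImB0 by simp_all
      then have "Im C * \<delta> < 0" using j by linarith
      then have neg: "\<delta> < 0" using Im_le(2) by (simp add: mult_less_0_iff)
      have "Im B * d1 \<le> Im C * (- \<delta>)" using j p by simp
      also have "\<dots> \<le> Im B * (- \<delta>)" using ImB neg by (intro mult_right_mono) auto
      finally have "d1 \<le> - \<delta>" using ImB0 mult_le_cancel_left_pos by blast
      have "Im A * d2 \<le> Im C * (- \<delta>)" using j p by simp
      also have "\<dots> \<le> Im A * (- \<delta>)" using ImA neg by (intro mult_right_mono) auto
      finally have "d2 \<le> - \<delta>" using ImA0 mult_le_cancel_left_pos by blast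
      show ?thesis using d neg \<open>d1 \<le> - \<delta>\<close> \<open>d2 \<le> - \<delta>\<close> by (simp add: field_simps)
    qed
    \<comment> \<open>The parameters of the common point are forced: as in the other direction,
      \<open>D1 = - (s * \<Delta>)\<close> and \<open>D2 = - ((1 - t) * \<Delta>)\<close>.\<close>
    have bds: "0 \<le> - D1 / \<Delta> \<and> - D1 / \<Delta> \<le> 1 \<and> 0 \<le> 1 + D2 / \<Delta> \<and> 1 + D2 / \<Delta> \<le> 1 \<and> \<Delta> \<noteq> 0"
    proof (cases "0 < D1")
      case True
      then show ?thesis using main[of D1 D2 \<Delta>] pos jac by (simp add: zero_less_mult_iff)
    next
      case False
      then have "0 < - D1" "0 < - D2" using pos by (auto simp: zero_less_mult_iff)
      then show ?thesis using main[of "- D1" "- D2" "- \<Delta>"] jac by simp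
    qed
    have "P + (1 + D2 / \<Delta>) *\<^sub>R A = U + (- D1 / \<Delta>) *\<^sub>R B"
    proof -
      have "\<Delta> * Re (P + (1 + D2 / \<Delta>) *\<^sub>R A) = \<Delta> * Re (U + (- D1 / \<Delta>) *\<^sub>R B)"
        using bds by (simp add: field_simps) (simp add: A_def B_def C_def D1_def D2_def \<Delta>_def cross_prod_def algebra_simps)
      moreover have "\<Delta> * Im (P + (1 + D2 / \<Delta>) *\<^sub>R A) = \<Delta> * Im (U + (- D1 / \<Delta>) *\<^sub>R B)"
        using bds by (simp add: field_simps) (simp add: A_def B_def C_def D1_def D2_def \<Delta>_def cross_prod_def algebra_simps)
      ultimately show ?thesis using bds by (simp add: complex_eq_iff)
    qed
    then show "\<exists>z. z \<in> closed_segment P Q \<and> z \<in> closed_segment U W"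
      unfolding in_closed_segment_complex A_def[symmetric] B_def[symmetric] using bds by metis
  qed
qed

section \<open>Half-edges of a plane drawing\<close>

lemma cross_prod_commute: "cross_prod w z = - cross_prod z w"
  by (simp add: cross_prod_def)

locale plane_drawing =
  fixes V :: "'v set" and E :: "'v set set" and pos :: "'v \<Rightarrow> complex" and x :: "'v set \<Rightarrow> complex"
  assumes plane: "plane_graph V E pos"
begin

definition below :: "'v \<Rightarrow> 'v \<Rightarrow> bool" where
  "below v w \<longleftrightarrow> upward (pos w - pos v)"

text \<open>Upward directions are those with positive argument, so at each vertex the half-edges
  going down precede those going up.\<close>

definition hless :: "'v \<times> 'v \<Rightarrow> 'v \<times> 'v \<Rightarrow> bool" where
  "hless h g \<longleftrightarrow> below (fst h) (fst g) \<or>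
     (fst h = fst g \<and> Arg (pos (snd h) - pos (fst h)) < Arg (pos (snd g) - pos (fst g)))"

definition halves :: "'v set set \<Rightarrow> ('v \<times> 'v) set" where
  "halves F = {(v, w). {v, w} \<in> F}"

text \<open>A negative cross product puts \<open>v\<close> to the right of the upward edge, so it is
  the edge that passes to the left of \<open>v\<close>.\<close>

definition leftof :: "'v \<times> 'v \<Rightarrow> 'v \<Rightarrow> bool" where
  "leftof h v \<longleftrightarrow> below (fst h) v \<and> below v (snd h) \<and>
     cross_prod (pos (snd h) - pos (fst h)) (pos v - pos (fst h)) < 0"

definition key :: "'v \<times> 'v \<Rightarrow> nat" where
  "key h = card {g \<in> halves E. hless g h}"

definition edge :: "'v \<times> 'v \<Rightarrow> 'v set" where "edge h = {fst h, snd h}"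

abbreviation neg :: "bool \<Rightarrow> complex" where "neg b \<equiv> (if b then -1 else 1)"

lemma edge_ends:
  assumes "{p, q} \<in> E"
  shows "p \<in> V" "q \<in> V" "p \<noteq> q" "pos p \<noteq> pos q"
proof -
  obtain a b where "{p, q} = {a, b}" "a \<in> V" "b \<in> V" "a \<noteq> b"
    using plane assms unfolding plane_graph_def by blast
  then show 1: "p \<in> V" "q \<in> V" "p \<noteq> q" by (auto simp: doubleton_eq_iff)
  then show "pos p \<noteq> pos q" using plane by (auto simp: plane_graph_def dest: inj_onD)
qed

lemma pos_inj: "v \<in> V \<Longrightarrow> w \<in> V \<Longrightarrow> pos v = pos w \<Longrightarrow> v = w"
  using plane by (auto simp: plane_graph_def dest: inj_onD)

lemma no_vertex_inside: "{p, q} \<in> E \<Longrightarrow> v \<in> V \<Longrightarrow> pos v \<notin> open_segment (pos p) (pos q)"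
  using plane by (auto simp: plane_graph_def)

lemma finite_V: "finite V"
  using plane by (simp add: plane_graph_def)

lemma finite_E: "finite E"
proof (rule finite_subset)
  show "E \<subseteq> Pow V" using plane by (auto simp: plane_graph_def)
qed (simp add: finite_V)

lemma finite_halves: "F \<subseteq> E \<Longrightarrow> finite (halves F)"
  by (rule finite_subset[of _ "V \<times> V"]) (auto simp: halves_def finite_V dest: edge_ends)

lemma below_trans: "below a b \<Longrightarrow> below b c \<Longrightarrow> below a c"
  using upward_trans by (auto simp: below_def)

lemma below_asym: "below a b \<Longrightarrow> \<not> below b a"
  using upward_asym by (auto simp: below_def)

lemma below_irrefl [simp]: "\<not> below a a"
  by (simp add: below_def)

lemma below_linear: "a \<in> V \<Longrightarrow> b \<in> V \<Longrightarrow> a \<noteq> b \<Longrightarrow> below a b \<or> below b a"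
  unfolding below_def using upward_linear pos_inj by blast

lemma cross_prod_nonzero:
  assumes "{p, q} \<in> E" "v \<in> V" "below p v" "below v q"
  shows "cross_prod (pos q - pos p) (pos v - pos p) \<noteq> 0"
  using collinear_between[of "pos q" "pos p" "pos v"] no_vertex_inside[OF assms(1,2)] assms(3,4)
  by (auto simp: below_def)

text \<open>If two neighbours lay in the same direction from \<open>v\<close>, the nearer one would
  be inside the edge to the farther one. Which one is nearer follows from \<open>below\<close> and
  from whether the common direction is upward.\<close>

lemma Arg_neq:
  assumes "{v, p} \<in> E" "{v, q} \<in> E" "p \<noteq> q"
  shows "Arg (pos p - pos v) \<noteq> Arg (pos q - pos v)"
proof
  assume eq: "Arg (pos p - pos v) = Arg (pos q - pos v)"
  have main: False
    if e: "{v, p} \<in> E" "{v, q} \<in> E" and b: "below p q" and eq: "Arg (pos p - pos v) = Arg (pos q - pos v)" for p q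
  proof -
    have z: "cross_prod (pos p - pos v) (pos q - pos v) = 0" by (simp add: cross_prod_Arg eq)
    have up: "upward (pos p - pos v) \<longleftrightarrow> upward (pos q - pos v)" by (simp add: upward_iff_Arg eq)
    show False
    proof (cases "upward (pos p - pos v)")
      case True
      have "cross_prod (pos q - pos v) (pos p - pos v) = 0" using z cross_prod_commute[of "pos q - pos v"] by simp
      then show False
        using True b cross_prod_nonzero[of v q p] e edge_ends by (auto simp: below_def)
    next
      case False
      then have "upward (pos v - pos q)"
        using up upward_linear edge_ends[OF e(2)] by metis
      moreover have "cross_prod (pos v - pos p) (pos q - pos p) = 0"
        using z by (simp add: cross_prod_def algebra_simps)
      ultimately show False
        using b cross_prod_nonzero[of p v q] e edge_ends by (auto simp: below_def insert_commute)
    qed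
  qed
  have "below p q \<or> below q p" using below_linear edge_ends assms by metis
  then show False using main assms(1,2) eq by metis
qed

lemma in_halves [simp]: "(v, w) \<in> halves F \<longleftrightarrow> {v, w} \<in> F"
  by (simp add: halves_def)

lemma hless_trans:
  "hless a b \<Longrightarrow> hless b c \<Longrightarrow> hless a c"
  using below_trans by (auto simp: hless_def)

lemma hless_irrefl [simp]: "\<not> hless a a"
  by (simp add: hless_def)

lemma hless_linear:
  assumes "a \<in> halves E" "b \<in> halves E" "a \<noteq> b"
  shows "hless a b \<or> hless b a"
proof -
  obtain v w v' w' where ab: "a = (v, w)" "b = (v', w')" by (metis surj_pair)
  show ?thesis
  proof (cases "v = v'")
    case True
    then show ?thesis using ab assms Arg_neq[of v w w'] by (auto simp: hless_def)
  next
    case False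
    then show ?thesis using ab assms below_linear[of v v'] edge_ends by (auto simp: hless_def)
  qed
qed

lemma key_less_iff:
  assumes "a \<in> halves E" "b \<in> halves E"
  shows "key a < key b \<longleftrightarrow> hless a b"
proof -
  have mono: "key c < key d" if "hless c d" "c \<in> halves E" for c d
  proof -
    have "{g \<in> halves E. hless g c} \<subset> {g \<in> halves E. hless g d}"
    proof
      show "{g \<in> halves E. hless g c} \<subseteq> {g \<in> halves E. hless g d}"
        using that(1) hless_trans by blast
      have "c \<in> {g \<in> halves E. hless g d}" "c \<notin> {g \<in> halves E. hless g c}" using that by simp_all
      then show "{g \<in> halves E. hless g c} \<noteq> {g \<in> halves E. hless g d}" by blast
    qed
    then show ?thesis unfolding key_def using finite_halves by (intro psubset_card_mono) auto
  qed
  show ?thesis using mono[of a b] mono[of b a] hless_linear[OF assms] assms by fastforce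
qed

sublocale ordered_matching "halves E" key prod.swap fst "\<lambda>h. x (edge h)"
proof
  show "finite (halves E)" by (simp add: finite_halves)
  show "inj_on key (halves E)"
    by (rule inj_onI) (metis hless_linear key_less_iff less_irrefl_nat)
  show "prod.swap a \<noteq> a" if "a \<in> halves E" for a
    using that edge_ends by (cases a) auto
  show "fst b = fst a"
    if "a \<in> halves E" "b \<in> halves E" "c \<in> halves E" "key a < key b" "key b < key c" "fst a = fst c" for a b c
    using that key_less_iff below_asym by (auto simp: hless_def)
qed (auto simp: halves_def edge_def insert_commute)

lemma lower_iff: "(p, q) \<in> halves E \<Longrightarrow> (p, q) \<in> lower \<longleftrightarrow> below p q"
  using key_less_iff[of "(p, q)" "(q, p)"] edge_ends[of p q]
  by (auto simp: lower_def hless_def insert_commute)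

lemma edges_cross_iff:
  "edges_cross V pos {p, q} {u, w} \<longleftrightarrow>
    (\<exists>z. z \<in> closed_segment (pos p) (pos q) \<and> z \<in> closed_segment (pos u) (pos w) \<and> z \<notin> pos ` V)"
  by (simp add: edges_cross_def segment_convex_hull)

text \<open>A vertex on a closed edge is one of its ends, so a common point of two edges without a
  common end is never a vertex.\<close>

lemma edges_cross_disjoint_iff:
  assumes "{p, q} \<in> E" "{u, w} \<in> E" "{p, q} \<inter> {u, w} = {}"
  shows "edges_cross V pos {p, q} {u, w} \<longleftrightarrow>
    (\<exists>z. z \<in> closed_segment (pos p) (pos q) \<and> z \<in> closed_segment (pos u) (pos w))"
proof -
  have "z \<notin> pos ` V" if "z \<in> closed_segment (pos p) (pos q)" "z \<in> closed_segment (pos u) (pos w)" for z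
  proof
    assume "z \<in> pos ` V"
    then obtain v where v: "v \<in> V" "z = pos v" by auto
    have "v \<in> {a, b}" if "{a, b} \<in> E" "pos v \<in> closed_segment (pos a) (pos b)" for a b
      using that no_vertex_inside[OF that(1) v(1)] pos_inj[OF v(1)] edge_ends[OF that(1)]
      by (auto simp: open_segment_def)
    then have "v \<in> {p, q}" "v \<in> {u, w}" using that v assms by blast+
    then show False using assms by blast
  qed
  then show ?thesis unfolding edges_cross_iff by blast
qed

lemma not_edges_cross_common:
  assumes "{v, p} \<in> E" "cross_prod (pos p - pos v) (pos q - pos v) \<noteq> 0"
  shows "\<not> edges_cross V pos {v, p} {v, q}"
proof
  assume "edges_cross V pos {v, p} {v, q}"
  then obtain t s where eq: "pos v + t *\<^sub>R (pos p - pos v) = pos v + s *\<^sub>R (pos q - pos v)"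
    and nV: "pos v + t *\<^sub>R (pos p - pos v) \<notin> pos ` V"
    unfolding edges_cross_iff in_closed_segment_complex by metis
  have "t * cross_prod (pos p - pos v) (pos q - pos v) =
      cross_prod (t *\<^sub>R (pos p - pos v)) (pos q - pos v)" by (simp add: cross_prod_def algebra_simps)
  also have "\<dots> = cross_prod (s *\<^sub>R (pos q - pos v)) (pos q - pos v)" using eq by simp
  also have "\<dots> = 0" by (simp add: cross_prod_def algebra_simps)
  finally have "t = 0" using assms by simp
  then show False using nV assms edge_ends by auto
qed

text \<open>Two edges cross iff their left-right order differs between the lowest and the highest level that
  they share; each of these levels is that of an end vertex, where \<open>leftof\<close> reads off the order.\<close>

lemma pair_sign:
  assumes e: "{p, q} \<in> E" "{u, w} \<in> E" and up: "below p q" "below u w" and less: "hless (p, q) (u, w)"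
  shows "neg (edges_cross V pos {p, q} {u, w}) =
    neg (hless (u, w) (q, p) \<and> hless (q, p) (w, u)) *
    ((neg (leftof (p, q) u) * neg (leftof (p, q) w)) * (neg (leftof (u, w) p) * neg (leftof (u, w) q)))"
proof -
  have V: "p \<in> V" "q \<in> V" "u \<in> V" "w \<in> V" using e edge_ends by blast+
  have pne: "pos p \<noteq> pos q" "pos u \<noteq> pos w" using e edge_ends by blast+
  let ?D1 = "cross_prod (pos q - pos p) (pos u - pos p)"
  let ?D2 = "cross_prod (pos w - pos u) (pos q - pos u)"
  let ?D3 = "cross_prod (pos q - pos p) (pos w - pos p)"
  \<comment> \<open>By \<open>less\<close>, the lower end \<open>p\<close> is at most
    \<open>u\<close>. The cases are: common lower end, no shared range of levels beyond possibly
    \<open>u = q\<close>, common upper end, and disjoint ends with the second edge ending before or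
    after the first.\<close>
  consider (start) "p = u" | (apart) "below p u" "\<not> below u q" | (top) "below p u" "below u q" "w = q"
    | (nested) "below p u" "below u q" "below w q" | (inter) "below p u" "below u q" "below q w"
    using less below_linear[of w q] V by (auto simp: hless_def)
  then show ?thesis
  proof cases
    case start
    then have A: "Arg (pos q - pos p) < Arg (pos w - pos p)" using less by (simp add: hless_def)
    then have pos: "0 < ?D3"
      using Arg_less_iff_cross_prod[of "pos q - pos p" "pos w - pos p"] start up pne
      by (simp add: below_def)
    have flip: "cross_prod (pos w - pos p) (pos q - pos p) = - ?D3"
      by (simp add: cross_prod_def)
    have nc: "\<not> edges_cross V pos {p, q} {u, w}"
      using not_edges_cross_common[of p q w] e pos start by simp
    have "q \<noteq> w" using A by auto
    then consider "below q w" "\<not> below w q" | "below w q" "\<not> below q w"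
      using below_linear below_asym V by blast
    then show ?thesis
      using nc start pos flip up \<open>q \<noteq> w\<close> by cases (auto simp: leftof_def hless_def)
  next
    case apart
    have nc: "\<not> edges_cross V pos {p, q} {u, w}"
    proof
      assume "edges_cross V pos {p, q} {u, w}"
      then obtain z where z: "z \<in> closed_segment (pos p) (pos q)" "z \<in> closed_segment (pos u) (pos w)" "z \<notin> pos ` V"
        unfolding edges_cross_iff by blast
      then have "upward (pos q - z)" "upward (z - pos u)"
        using segment_upward up V unfolding below_def by blast+
      then show False using apart upward_trans unfolding below_def by blast
    qed
    \<comment> \<open>This covers \<open>u = q\<close> as well: there the half-edge towards
      \<open>w\<close> goes up and the one towards \<open>p\<close> goes down, so the latter comes
      first.\<close>
    have "\<not> hless (u, w) (q, p)"
    proof -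
      have "\<not> upward (pos p - pos q)" "upward (pos w - pos u)"
        using up below_asym by (auto simp: below_def)
      then show ?thesis using apart by (auto simp: hless_def upward_iff_Arg)
    qed
    moreover have "\<not> below w q" "\<not> below u p" using apart up below_trans below_asym by blast+
    ultimately show ?thesis using nc apart by (simp add: leftof_def)
  next
    case top
    have flip: "cross_prod (pos p - pos q) (pos u - pos q) = - ?D1"
      by (simp add: cross_prod_def algebra_simps)
    have ne: "?D1 \<noteq> 0" using cross_prod_nonzero e(1) V top by blast
    have nc: "\<not> edges_cross V pos {p, q} {u, w}"
      using not_edges_cross_common[of q p u] e ne flip top by (simp add: insert_commute)
    have "\<not> upward (pos p - pos q)" "\<not> upward (pos u - pos q)"
      using up top upward_asym by (auto simp: below_def)
    then have "hless (q, p) (w, u) \<longleftrightarrow> ?D1 < 0"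
      using Arg_less_iff_cross_prod[of "pos p - pos q" "pos u - pos q"] top pne flip by (simp add: hless_def)
    moreover have "hless (u, w) (q, p)" using top by (simp add: hless_def)
    moreover have "\<not> below u p" using top below_asym by blast
    ultimately show ?thesis using nc top by (simp add: leftof_def)
  next
    case nested
    have ne: "?D1 \<noteq> 0" "?D3 \<noteq> 0"
      using cross_prod_nonzero e(1) V nested below_trans up by blast+
    have "{p, q} \<inter> {u, w} = {}"
    proof -
      have "below p w" using nested up below_trans by blast
      then show ?thesis using nested by auto
    qed
    then have "edges_cross V pos {p, q} {u, w} \<longleftrightarrow> ?D1 * ?D3 < 0"
      using edges_cross_disjoint_iff e nested_segments_meet_iff[OF _ _ _ ne] nested up
      by (simp add: below_def)
    moreover have "\<not> hless (q, p) (w, u)" using nested below_asym by (auto simp: hless_def)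
    moreover have "\<not> below u p" "\<not> below q w" using nested below_asym by blast+
    moreover have "below p w" using nested up below_trans by blast
    ultimately show ?thesis using nested ne by (auto simp: leftof_def mult_less_0_iff)
  next
    case inter
    have ne: "?D1 \<noteq> 0" "?D2 \<noteq> 0"
      using cross_prod_nonzero e V inter by blast+
    have "{p, q} \<inter> {u, w} = {}"
    proof -
      have "below p w" using inter up below_trans by blast
      then show ?thesis using inter by auto
    qed
    then have "edges_cross V pos {p, q} {u, w} \<longleftrightarrow> 0 < ?D1 * ?D2"
      using edges_cross_disjoint_iff e interleaved_segments_meet_iff[OF _ _ _ ne] inter
      by (simp add: below_def)
    moreover have "hless (q, p) (w, u)" "hless (u, w) (q, p)" using inter by (auto simp: hless_def)
    moreover have "\<not> below u p" "\<not> below w q" using inter below_asym by blast+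
    ultimately show ?thesis using inter ne by (auto simp: leftof_def zero_less_mult_iff)
  qed
qed

end

section \<open>Crossings and interleaved chords\<close>

context plane_drawing
begin

lemma edge_swap [simp]: "edge (prod.swap h) = edge h"
  by (simp add: edge_def insert_commute)

lemma edge_inj_lower:
  assumes "a \<in> lower" "b \<in> lower" "edge a = edge b"
  shows "a = b"
proof -
  have "b = a \<or> b = prod.swap a"
    using assms(3) by (cases a, cases b) (auto simp: edge_def doubleton_eq_iff)
  then show ?thesis using assms(1,2) by (auto simp: lower_def)
qed

lemma inj_on_edge: "inj_on edge (S \<inter> lower)"
  using edge_inj_lower by (auto intro: inj_onI)

lemma edge_image_lower:
  assumes "F \<subseteq> E"
  shows "edge ` (halves F \<inter> lower) = F"
proof
  show "edge ` (halves F \<inter> lower) \<subseteq> F" by (auto simp: halves_def edge_def)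
  show "F \<subseteq> edge ` (halves F \<inter> lower)"
  proof
    fix e assume e: "e \<in> F"
    then obtain p q where pq: "e = {p, q}" using plane assms by (auto simp: plane_graph_def)
    then have E: "(p, q) \<in> halves E" "(p, q) \<in> halves F" "(q, p) \<in> halves F"
      using e assms by (auto simp: insert_commute)
    then have "(p, q) \<in> lower \<or> (q, p) \<in> lower" using lower_bar[of "(p, q)"] by auto
    then show "e \<in> edge ` (halves F \<inter> lower)"
      using E pq by (force simp: edge_def insert_commute)
  qed
qed

lemma halves_mono: "F \<subseteq> G \<Longrightarrow> halves F \<subseteq> halves G"
  by (auto simp: halves_def)

lemma swap_halves: "prod.swap ` halves F \<subseteq> halves F"
  by (auto simp: halves_def insert_commute)

lemma card_halves:
  assumes "F \<subseteq> E"
  shows "card (halves F) = 2 * card F"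
proof -
  let ?A = "halves F \<inter> lower"
  have fin: "finite (halves F)" using assms by (rule finite_halves)
  have A: "card ?A = card F"
    using card_image[OF inj_on_edge, of "halves F"] edge_image_lower[OF assms] by simp
  have "halves F - lower = prod.swap ` ?A"
  proof -
    have "h \<in> lower \<longleftrightarrow> prod.swap h \<notin> lower" if "h \<in> halves F" for h
      using that lower_bar halves_mono[OF assms] by blast
    moreover have "prod.swap h \<in> halves F" if "h \<in> halves F" for h
      using that swap_halves by blast
    ultimately show ?thesis
      by (intro equalityI subsetI) (metis DiffE IntI image_eqI swap_swap, metis DiffI IntE imageE swap_swap)
  qed
  then have "card (halves F - lower) = card ?A" by (simp add: card_image)
  moreover have "card (halves F) = card ?A + card (halves F - lower)"
    using fin by (metis card_Int_Diff)
  ultimately show ?thesis using A by simp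
qed

lemma block_degree:
  assumes "F \<subseteq> E"
  shows "card {h \<in> halves F. fst h = v} = card {e \<in> F. v \<in> e}"
proof -
  have "bij_betw edge {h \<in> halves F. fst h = v} {e \<in> F. v \<in> e}"
  proof (rule bij_betwI')
    fix h g assume "h \<in> {h \<in> halves F. fst h = v}" "g \<in> {h \<in> halves F. fst h = v}"
    then show "edge h = edge g \<longleftrightarrow> h = g"
      by (cases h, cases g) (auto simp: edge_def doubleton_eq_iff)
  next
    fix h assume "h \<in> {h \<in> halves F. fst h = v}"
    then show "edge h \<in> {e \<in> F. v \<in> e}" by (auto simp: edge_def halves_def)
  next
    fix e assume e: "e \<in> {e \<in> F. v \<in> e}"
    then obtain p q where "e = {p, q}" using plane assms by (auto simp: plane_graph_def)
    then obtain w where "e = {v, w}" using e by auto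
    then show "\<exists>h\<in>{h \<in> halves F. fst h = v}. e = edge h"
      using e by (intro bexI[of _ "(v, w)"]) (auto simp: edge_def)
  qed
  then show ?thesis by (rule bij_betw_same_card)
qed

lemma even_blocks_iff:
  assumes "F \<subseteq> E"
  shows "even_blocks (halves F) \<longleftrightarrow> even_subgraph V E F"
proof -
  have "{e \<in> F. v \<in> e} = {}" if "v \<notin> V" for v
    using that assms plane by (auto simp: plane_graph_def)
  then have "even (card {e \<in> F. v \<in> e})" if "v \<notin> V" for v using that by (metis card.empty even_zero)
  then show ?thesis
    using assms by (auto simp: even_blocks_def even_subgraph_def block_degree)
qed

lemma edges_cross_commute: "edges_cross V pos e f \<longleftrightarrow> edges_cross V pos f e"
  by (auto simp: edges_cross_def)

lemma minus_one_power_crossings: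
  assumes "F \<subseteq> E"
  defines "A \<equiv> halves F \<inter> lower"
  shows "(-1) ^ num_crossings V pos F =
    (\<Prod>(a, b)\<in>{(a, b). a \<in> A \<and> b \<in> A \<and> key a < key b}. neg (edges_cross V pos (edge a) (edge b)))"
proof -
  let ?P = "{(a, b). a \<in> A \<and> b \<in> A \<and> key a < key b}"
  let ?X = "{(a, b). a \<in> A \<and> b \<in> A \<and> key a < key b \<and> edges_cross V pos (edge a) (edge b)}"
  have finA: "finite A" using finite_halves[OF assms(1)] by (simp add: A_def)
  have finP: "finite ?P" by (rule finite_subset[of _ "A \<times> A"]) (use finA in auto)
  have inj: "a = b" if "a \<in> A" "b \<in> A" "edge a = edge b" for a b
    using that edge_inj_lower by (auto simp: A_def)
  have keyA: "key a = key b \<longleftrightarrow> a = b" if "a \<in> A" "b \<in> A" for a b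
  proof -
    have "a \<in> halves E" "b \<in> halves E" using that halves_mono[OF assms(1)] unfolding A_def by blast+
    then show ?thesis by (rule key_eq)
  qed
  have FA: "F = edge ` A" using edge_image_lower[OF assms(1)] by (simp add: A_def)
  have "bij_betw (\<lambda>(a, b). {edge a, edge b}) ?X
      {{e, f} | e f. e \<in> F \<and> f \<in> F \<and> e \<noteq> f \<and> edges_cross V pos e f}"
  proof (rule bij_betw_imageI)
    show "inj_on (\<lambda>(a, b). {edge a, edge b}) ?X"
    proof (rule inj_onI, clarify)
      fix a b c d
      assume *: "a \<in> A" "b \<in> A" "key a < key b" "c \<in> A" "d \<in> A" "key c < key d"
        and "{edge a, edge b} = {edge c, edge d}"
      then have "edge a = edge c \<and> edge b = edge d \<or> edge a = edge d \<and> edge b = edge c"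
        by (simp only: doubleton_eq_iff)
      then have "a = c \<and> b = d \<or> a = d \<and> b = c" using inj * by blast
      then show "a = c \<and> b = d" using * by auto
    qed
    show "(\<lambda>(a, b). {edge a, edge b}) ` ?X = {{e, f} | e f. e \<in> F \<and> f \<in> F \<and> e \<noteq> f \<and> edges_cross V pos e f}"
    proof (intro equalityI subsetI)
      fix s assume "s \<in> (\<lambda>(a, b). {edge a, edge b}) ` ?X"
      then obtain a b where ab: "s = {edge a, edge b}" "a \<in> A" "b \<in> A" "key a < key b"
        "edges_cross V pos (edge a) (edge b)" by auto
      then have "edge a \<noteq> edge b" using inj by blast
      then show "s \<in> {{e, f} | e f. e \<in> F \<and> f \<in> F \<and> e \<noteq> f \<and> edges_cross V pos e f}"
        using ab FA by blast
    next
      fix s assume "s \<in> {{e, f} | e f. e \<in> F \<and> f \<in> F \<and> e \<noteq> f \<and> edges_cross V pos e f}"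
      then obtain a b where ab: "s = {edge a, edge b}" "a \<in> A" "b \<in> A" "edge a \<noteq> edge b"
        "edges_cross V pos (edge a) (edge b)" unfolding FA by blast
      then consider "key a < key b" | "key b < key a" using keyA by (metis linorder_neqE_nat)
      then show "s \<in> (\<lambda>(a, b). {edge a, edge b}) ` ?X"
      proof cases
        case 1
        then show ?thesis using ab by (intro image_eqI[of _ _ "(a, b)"]) auto
      next
        case 2
        then show ?thesis using ab edges_cross_commute
          by (intro image_eqI[of _ _ "(b, a)"]) (auto simp: insert_commute)
      qed
    qed
  qed
  then have "num_crossings V pos F = card ?X"
    unfolding num_crossings_def by (rule bij_betw_same_card[symmetric])
  then have "(-1) ^ num_crossings V pos F = (\<Prod>(a, b)\<in>?X. -1 :: complex)" by simp
  also have "\<dots> = (\<Prod>(a, b)\<in>?P. neg (edges_cross V pos (edge a) (edge b)))"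
    by (rule prod.mono_neutral_cong_left) (use finP in \<open>auto split: if_splits\<close>)
  finally show ?thesis .
qed

text \<open>The factor of a half-edge depends only on its base vertex, so grouping by base raises
  each \<open>neg (leftof a v)\<close> to the degree of \<open>v\<close>.\<close>

lemma prod_leftof_even:
  assumes F: "F \<subseteq> E" and ev: "even_blocks (halves F)"
  shows "(\<Prod>b\<in>halves F \<inter> lower. neg (leftof a (fst b)) * neg (leftof a (snd b))) = 1"
proof -
  have fin: "finite (halves F)" using F by (rule finite_halves)
  have "(\<Prod>b\<in>halves F \<inter> lower. neg (leftof a (fst b)) * neg (leftof a (snd b))) =
      (\<Prod>h\<in>halves F. neg (leftof a (fst h)))"
    by (subst prod_lower_pairs[OF halves_mono[OF F] swap_halves]) simp
  also have "\<dots> = (\<Prod>v\<in>fst ` halves F. \<Prod>h\<in>{h \<in> halves F. fst h = v}. neg (leftof a (fst h)))"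
    by (rule prod.group[symmetric]) (use fin in auto)
  also have "\<dots> = (\<Prod>v\<in>fst ` halves F. neg (leftof a v) ^ card {h \<in> halves F. fst h = v})"
    by (intro prod.cong refl) simp
  also have "\<dots> = 1"
    using ev by (intro prod.neutral) (auto simp: even_blocks_def)
  finally show ?thesis .
qed

text \<open>The \<open>leftof\<close> terms of \<open>pair_sign\<close> cancel in the product because all degrees are even.\<close>

lemma chord_sign_crossings:
  assumes F: "F \<subseteq> E" and ev: "even_blocks (halves F)"
  shows "chord_sign (halves F) = (-1) ^ num_crossings V pos F"
proof -
  define A where "A = halves F \<inter> lower"
  define L where "L a b = neg (leftof a (fst b)) * neg (leftof a (snd b))" for a b
  let ?P = "{(a, b). a \<in> A \<and> b \<in> A \<and> key a < key b}"
  let ?P' = "{(a, b). a \<in> A \<and> b \<in> A \<and> key b < key a}"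
  have finA: "finite A" using finite_halves[OF F] by (simp add: A_def)
  have finP: "finite ?P" "finite ?P'"
    by (rule finite_subset[of _ "A \<times> A"], use finA in auto)+
  have AE: "A \<subseteq> halves E" using halves_mono[OF F] by (auto simp: A_def)
  have L_self: "L a a = 1" for a by (simp add: L_def leftof_def)
  \<comment> \<open>Both orders of each pair occur, so this is the product over all of
    \<open>A \<times> A\<close>, whose diagonal contributes 1; then \<open>prod_leftof_even\<close>
    applies for each fixed \<open>a\<close>.\<close>
  have "(\<Prod>(a, b)\<in>?P. L a b * L b a) = (\<Prod>(a, b)\<in>?P. L a b) * (\<Prod>(a, b)\<in>?P. L b a)"
    by (simp add: prod.distrib case_prod_unfold)
  also have "(\<Prod>(a, b)\<in>?P. L b a) = (\<Prod>(a, b)\<in>?P'. L a b)"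
    by (rule prod.reindex_bij_witness[of _ prod.swap prod.swap]) auto
  also have "(\<Prod>(a, b)\<in>?P. L a b) * (\<Prod>(a, b)\<in>?P'. L a b) = (\<Prod>(a, b)\<in>?P \<union> ?P'. L a b)"
    by (rule prod.union_disjoint[symmetric]) (use finP in auto)
  also have "\<dots> = (\<Prod>(a, b)\<in>A \<times> A. L a b)"
  proof (rule prod.mono_neutral_left)
    show "\<forall>i\<in>A \<times> A - (?P \<union> ?P'). (case i of (a, b) \<Rightarrow> L a b) = 1"
      using key_eq AE L_self by (auto simp: subset_iff) (metis linorder_neqE_nat)
  qed (use finA in auto)
  also have "\<dots> = (\<Prod>a\<in>A. \<Prod>b\<in>A. L a b)" by (simp add: prod.cartesian_product)
  also have "\<dots> = 1"
    using prod_leftof_even[OF F ev] by (simp add: A_def L_def)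
  finally have LL: "(\<Prod>(a, b)\<in>?P. L a b * L b a) = 1" .
  have "chord_sign (halves F) = (\<Prod>(a, b)\<in>A \<times> A. interleave a b)"
    by (simp add: chord_sign_def A_def prod.cartesian_product)
  also have "\<dots> = (\<Prod>(a, b)\<in>?P. interleave a b)"
    by (rule prod.mono_neutral_right) (use finA in \<open>auto simp: interleave_def split: if_splits\<close>)
  also have "\<dots> = (\<Prod>(a, b)\<in>?P. interleave a b) * (\<Prod>(a, b)\<in>?P. L a b * L b a)"
    by (simp only: LL mult_1_right)
  also have "\<dots> = (\<Prod>(a, b)\<in>?P. interleave a b * (L a b * L b a))"
    by (simp add: prod.distrib case_prod_unfold)
  also have "\<dots> = (\<Prod>(a, b)\<in>?P. neg (edges_cross V pos (edge a) (edge b)))"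
  proof (intro prod.cong refl, clarify)
    fix p q u w assume *: "(p, q) \<in> A" "(u, w) \<in> A" "key (p, q) < key (u, w)"
    then have E: "(p, q) \<in> halves E" "(u, w) \<in> halves E" "(q, p) \<in> halves E" "(w, u) \<in> halves E"
      using AE by (auto simp: insert_commute)
    have "below p q" "below u w" using * lower_iff E by (auto simp: A_def)
    moreover have "interleave (p, q) (u, w) = neg (hless (u, w) (q, p) \<and> hless (q, p) (w, u))"
      using *(3) E by (simp add: interleave_def key_less_iff)
    moreover have "hless (p, q) (u, w)" using *(3) E key_less_iff by blast
    ultimately show "interleave (p, q) (u, w) * (L (p, q) (u, w) * L (u, w) (p, q)) =
        neg (edges_cross V pos (edge (p, q)) (edge (u, w)))"
      using pair_sign[of p q u w] E by (simp add: L_def edge_def)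
  qed
  also have "\<dots> = (-1) ^ num_crossings V pos F"
    unfolding minus_one_power_crossings[OF F] A_def ..
  finally show ?thesis .
qed

lemma closed_half_sets:
  assumes "S \<subseteq> halves E" "prod.swap ` S \<subseteq> S"
  shows "S = halves (edge ` S)" "edge ` S \<subseteq> E"
proof -
  show "edge ` S \<subseteq> E" using assms(1) by (auto simp: edge_def halves_def)
  show "S = halves (edge ` S)"
  proof (intro equalityI subsetI)
    fix h assume "h \<in> S"
    then show "h \<in> halves (edge ` S)" by (cases h) (force simp: edge_def halves_def)
  next
    fix h assume "h \<in> halves (edge ` S)"
    then obtain g where g: "g \<in> S" "edge h = edge g" by (cases h) (auto simp: edge_def)
    then have "h = g \<or> h = prod.swap g"
      by (cases h, cases g) (auto simp: edge_def doubleton_eq_iff)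
    then show "h \<in> S" using g assms(2) by auto
  qed
qed

text \<open>A set in the support of \<open>matched\<close> is closed under swapping and so consists
  of both halves of each of its edges; even blocks then say even degrees.\<close>

lemma part_eq_even_subgraphs:
  "part n = (\<Sum>F\<in>{F. even_subgraph V E F \<and> card F = n}. (-1) ^ num_crossings V pos F * (\<Prod>e\<in>F. x e))"
proof -
  have fin: "finite (Pow (halves E))" by (simp add: finite_halves)
  have "part n = (\<Sum>S\<in>{S \<in> Pow (halves E). prod.swap ` S \<subseteq> S \<and> card S = 2 * n \<and> even_blocks S}. matched n S)"
    unfolding part_def bracket_def
    by (rule sum.mono_neutral_cong_right) (use fin in \<open>auto simp: matched_def\<close>)
  also have "\<dots> = (\<Sum>F\<in>{F. even_subgraph V E F \<and> card F = n}. (-1) ^ num_crossings V pos F * (\<Prod>e\<in>F. x e))"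
  proof (rule sum.reindex_bij_witness[of _ halves "\<lambda>S. edge ` S"])
    fix S assume "S \<in> {S \<in> Pow (halves E). prod.swap ` S \<subseteq> S \<and> card S = 2 * n \<and> even_blocks S}"
    then have S: "S \<subseteq> halves E" "prod.swap ` S \<subseteq> S" "card S = 2 * n" "even_blocks S" by auto
    note F = closed_half_sets[OF S(1,2)]
    show "halves (edge ` S) = S" using F(1) ..
    have ev: "even_blocks (halves (edge ` S))" using S(4) F(1) by simp
    have "2 * card (edge ` S) = 2 * n" using card_halves[OF F(2)] S(3) F(1) by simp
    then show "edge ` S \<in> {F. even_subgraph V E F \<and> card F = n}"
      using ev even_blocks_iff[OF F(2)] by simp
    have "(\<Prod>e\<in>edge ` S. x e) = (\<Prod>a\<in>S \<inter> lower. x (edge a))"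
    proof -
      have "edge ` S = edge ` (S \<inter> lower)" using edge_image_lower[OF F(2)] F(1) by simp
      then show ?thesis by (simp add: prod.reindex[OF inj_on_edge] o_def)
    qed
    then show "(-1) ^ num_crossings V pos (edge ` S) * (\<Prod>e\<in>edge ` S. x e) = matched n S"
      using chord_sign_crossings[OF F(2) ev] S F(1) by (simp add: matched_def)
  next
    fix F assume "F \<in> {F. even_subgraph V E F \<and> card F = n}"
    then have F: "F \<subseteq> E" "even_subgraph V E F" "card F = n" by (auto simp: even_subgraph_def)
    show "edge ` halves F = F"
      using edge_image_lower[OF F(1)] by (auto simp: halves_def edge_def)
    show "halves F \<in> {S \<in> Pow (halves E). prod.swap ` S \<subseteq> S \<and> card S = 2 * n \<and> even_blocks S}"
      using halves_mono[OF F(1)] swap_halves card_halves[OF F(1)] F even_blocks_iff[OF F(1)] by simp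
  qed
  finally show ?thesis .
qed

end

section \<open>Closed walks\<close>

lemma sum_lists_Suc:
  fixes f :: "'a list \<Rightarrow> 'b::comm_monoid_add"
  assumes "finite A"
  shows "(\<Sum>xs | set xs \<subseteq> A \<and> length xs = Suc n. f xs) =
    (\<Sum>a\<in>A. \<Sum>xs | set xs \<subseteq> A \<and> length xs = n. f (a # xs))"
proof -
  let ?L = "{xs. set xs \<subseteq> A \<and> length xs = n}"
  have "(\<Sum>xs | set xs \<subseteq> A \<and> length xs = Suc n. f xs) = (\<Sum>(xs, a)\<in>?L \<times> A. f (a # xs))"
    unfolding lists_length_Suc_eq by (subst sum.reindex) (auto simp: inj_on_def case_prod_unfold o_def)
  also have "\<dots> = (\<Sum>xs\<in>?L. \<Sum>a\<in>A. f (a # xs))" by (simp add: sum.cartesian_product)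
  also have "\<dots> = (\<Sum>a\<in>A. \<Sum>xs\<in>?L. f (a # xs))" by (rule sum.swap)
  finally show ?thesis .
qed

lemma next_index: "i < m \<Longrightarrow> (i + 1) mod m = (if i + 1 = m then 0 else i + 1)" for i m :: nat
  by auto

lemma prev_index: "i < m \<Longrightarrow> (i + m - 1) mod m = (if i = 0 then m - 1 else i - 1)" for i m :: nat
  by (cases i) auto

lemma prev_next_index: "i < m \<Longrightarrow> ((i + 1) mod m + m - 1) mod m = i" for i m :: nat
  by (subst next_index) auto

lemma next_prev_index: "i < m \<Longrightarrow> ((i + m - 1) mod m + 1) mod m = i" for i m :: nat
  by (subst prev_index) auto

lemma bij_betw_next_index: "bij_betw (\<lambda>i. (i + 1) mod m) {..<m} {..<m}" for m :: nat
proof (rule bij_betw_byWitness)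
  show "\<forall>i\<in>{..<m}. ((i + 1) mod m + m - 1) mod m = i" using prev_next_index by blast
  show "\<forall>i\<in>{..<m}. ((i + m - 1) mod m + 1) mod m = i" using next_prev_index by blast
qed auto

lemma prod_next_index: "(\<Prod>i<m. f ((i + 1) mod m)) = (\<Prod>i<m. f i)" for m :: nat
  by (rule prod.reindex_bij_betw[OF bij_betw_next_index])

lemma sum_next_index: "(\<Sum>i<m. f ((i + 1) mod m)) = (\<Sum>i<m. f i)" for m :: nat
  by (rule sum.reindex_bij_betw[OF bij_betw_next_index])

context ordered_matching
begin

fun walk :: "nat \<Rightarrow> 'h \<Rightarrow> 'h \<Rightarrow> complex" where
  "walk 0 b a = turn b a"
| "walk (Suc k) b a = (\<Sum>c\<in>H. turn b c * dirsgn c * x c * walk k (bar c) a)"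

text \<open>Unrolling \<open>corr_Suc\<close>: the marked half-edge uses up \<open>k\<close> chords
  before it is contracted with \<open>a\<close>, and the other chords leave
  \<open>part (n - k)\<close>.\<close>

lemma corr_eq_walks:
  assumes "a \<in> H" "b \<in> H"
  shows "corr n b a = (\<Sum>k\<le>n. walk k b a * part (n - k))"
  using assms(2)
proof (induction n arbitrary: b)
  case 0
  then show ?case using corr_0 assms(1) by simp
next
  case (Suc n)
  have "(\<Sum>c\<in>H. turn b c * dirsgn c * x c * corr n (bar c) a) =
      (\<Sum>c\<in>H. \<Sum>k\<le>n. turn b c * dirsgn c * x c * walk k (bar c) a * part (n - k))"
    using Suc.IH bar_in by (simp add: sum_distrib_left mult.assoc)
  also have "\<dots> = (\<Sum>k\<le>n. \<Sum>c\<in>H. turn b c * dirsgn c * x c * walk k (bar c) a * part (n - k))"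
    by (rule sum.swap)
  also have "\<dots> = (\<Sum>k\<le>n. walk (Suc k) b a * part (n - k))"
    by (simp add: sum_distrib_right)
  finally have "corr (Suc n) b a = walk 0 b a * part (Suc n) + (\<Sum>k\<le>n. walk (Suc k) b a * part (n - k))"
    using corr_Suc[OF assms(1) Suc.prems] by simp
  then show ?case by (subst sum.atMost_Suc_shift) simp
qed

fun path_weight :: "'h \<Rightarrow> 'h list \<Rightarrow> 'h \<Rightarrow> complex" where
  "path_weight b [] a = turn b a"
| "path_weight b (c # cs) a = turn b c * dirsgn c * x c * path_weight (bar c) cs a"

lemma walk_eq_paths:
  "walk k b a = (\<Sum>cs | set cs \<subseteq> H \<and> length cs = k. path_weight b cs a)"
proof (induction k arbitrary: b)
  case 0
  have "{cs. set cs \<subseteq> H \<and> length cs = 0} = {[]}" by auto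
  then show ?case by simp
next
  case (Suc k)
  then show ?case by (simp add: sum_lists_Suc[OF fin] sum_distrib_left)
qed

text \<open>The start \<open>c\<close> and the end \<open>e\<close> are kept independent for the
  induction; \<open>path_weight_cycle\<close> closes the walk by identifying them.\<close>

lemma path_weight_prod:
  "path_weight (bar c) cs e * (dirsgn e * x e) =
    (\<Prod>i<Suc (length cs). turn (bar ((c # cs) ! i)) ((cs @ [e]) ! i) * (dirsgn ((cs @ [e]) ! i) * x ((cs @ [e]) ! i)))"
proof (induction cs arbitrary: c)
  case Nil
  then show ?case by simp
next
  case (Cons d cs)
  have "path_weight (bar c) (d # cs) e * (dirsgn e * x e) =
      turn (bar c) d * (dirsgn d * x d) * (path_weight (bar d) cs e * (dirsgn e * x e))"
    by simp
  then show ?case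
    unfolding Cons.IH length_Cons by (subst prod.lessThan_Suc_shift) simp
qed

definition cycle_weight :: "'h list \<Rightarrow> complex" where
  "cycle_weight ds = (\<Prod>i<length ds. dirsgn (ds ! i) * x (ds ! i) *
     turn (bar (ds ! i)) (ds ! ((i + 1) mod length ds)))"

lemma path_weight_cycle:
  "path_weight (bar e) cs e * (dirsgn e * x e) = cycle_weight (e # cs)"
proof -
  let ?ds = "e # cs" and ?m = "Suc (length cs)"
  have shift: "(cs @ [e]) ! i = ?ds ! ((i + 1) mod ?m)" if "i < ?m" for i
    using that by (subst next_index[OF that]) (auto simp: nth_append)
  have "path_weight (bar e) cs e * (dirsgn e * x e) =
      (\<Prod>i<?m. turn (bar (?ds ! i)) (?ds ! ((i + 1) mod ?m)) * (dirsgn (?ds ! ((i + 1) mod ?m)) * x (?ds ! ((i + 1) mod ?m))))"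
    unfolding path_weight_prod by (rule prod.cong) (simp_all only: shift lessThan_iff)
  also have "\<dots> = (\<Prod>i<?m. turn (bar (?ds ! i)) (?ds ! ((i + 1) mod ?m))) * (\<Prod>i<?m. dirsgn (?ds ! i) * x (?ds ! i))"
    unfolding prod.distrib[of _ "\<lambda>i. dirsgn (?ds ! ((i + 1) mod ?m)) * x (?ds ! ((i + 1) mod ?m))"]
    by (simp only: prod_next_index[of "\<lambda>i. dirsgn (?ds ! i) * x (?ds ! i)" ?m])
  also have "\<dots> = cycle_weight ?ds"
    by (simp only: cycle_weight_def prod.distrib length_Cons mult.commute)
  finally show ?thesis .
qed

lemma dirsgn_bar: "a \<in> H \<Longrightarrow> dirsgn (bar a) = - dirsgn a"
  using key_eq[of a "bar a"] bar_in[of a] bar_ne[of a] by (auto simp: dirsgn_def bar_bar)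

text \<open>Substituting \<open>a = bar e\<close> turns \<open>dirsgn a\<close> into
  \<open>- dirsgn e\<close>. This is the minus sign of a closed fermion line, and it becomes the one
  in \<open>loop_sgn\<close>.\<close>

lemma walk_trace:
  "(\<Sum>a\<in>H. dirsgn a * x a * walk k a (bar a)) =
    - (\<Sum>ds | set ds \<subseteq> H \<and> length ds = Suc k. cycle_weight ds)"
proof -
  have "(\<Sum>a\<in>H. dirsgn a * x a * walk k a (bar a)) =
      (\<Sum>e\<in>H. dirsgn (bar e) * x (bar e) * walk k (bar e) e)"
    by (rule sum.reindex_bij_witness[of _ bar bar]) (auto simp: bar_in bar_bar)
  also have "\<dots> = (\<Sum>e\<in>H. \<Sum>cs | set cs \<subseteq> H \<and> length cs = k. - cycle_weight (e # cs))"
  proof (intro sum.cong refl)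
    fix e assume "e \<in> H"
    then have "dirsgn (bar e) * x (bar e) * walk k (bar e) e = - (walk k (bar e) e * (dirsgn e * x e))"
      by (simp add: dirsgn_bar x_bar)
    then show "dirsgn (bar e) * x (bar e) * walk k (bar e) e =
        (\<Sum>cs | set cs \<subseteq> H \<and> length cs = k. - cycle_weight (e # cs))"
      by (simp add: walk_eq_paths sum_distrib_right path_weight_cycle sum_negf)
  qed
  finally show ?thesis by (simp add: sum_lists_Suc[OF fin] sum_negf)
qed

lemma part_recursion:
  "2 * of_nat (Suc n) * part (Suc n) =
    (\<Sum>k\<le>n. part (n - k) * - (\<Sum>ds | set ds \<subseteq> H \<and> length ds = Suc k. cycle_weight ds))"
proof -
  have "2 * of_nat (Suc n) * part (Suc n) =
      (\<Sum>a\<in>H. \<Sum>k\<le>n. dirsgn a * x a * (walk k a (bar a) * part (n - k)))"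
    unfolding part_corr by (simp add: corr_eq_walks bar_in sum_distrib_left)
  also have "\<dots> = (\<Sum>k\<le>n. \<Sum>a\<in>H. dirsgn a * x a * (walk k a (bar a) * part (n - k)))"
    by (rule sum.swap)
  also have "\<dots> = (\<Sum>k\<le>n. part (n - k) * (\<Sum>a\<in>H. dirsgn a * x a * walk k a (bar a)))"
    by (simp add: sum_distrib_left mult_ac)
  finally show ?thesis by (simp only: walk_trace)
qed

end

section \<open>Corner signs and geometric weights of closed walks\<close>

context plane_drawing
begin

text \<open>The sign that \<open>exp_half_turn_corner\<close> extracts from half the turning angle
  of the step from \<open>p\<close> over \<open>v\<close> to \<open>q\<close>.\<close>

definition corner :: "'v \<Rightarrow> 'v \<Rightarrow> 'v \<Rightarrow> complex" where
  "corner p v q = dirsgn (p, v) * turn (v, p) (v, q)"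

definition walk_weight :: "'v list \<Rightarrow> complex" where
  "walk_weight vs = loop_sgn pos vs * (\<Prod>i<length vs. x {vs ! i, vs ! ((i + 1) mod length vs)})"

lemma closed_gpath_corner:
  assumes "closed_gpath E vs" "i < length vs"
  defines "n \<equiv> length vs"
  shows "{vs ! ((i + n - 1) mod n), vs ! i} \<in> E" "{vs ! i, vs ! ((i + 1) mod n)} \<in> E"
    "vs ! ((i + n - 1) mod n) \<noteq> vs ! ((i + 1) mod n)"
proof -
  define j where "j = (i + n - 1) mod n"
  have j: "j < n" "(j + 1) mod n = i" "(j + 2) mod n = (i + 1) mod n"
  proof -
    show "j < n" unfolding j_def n_def using assms(2) by (intro mod_less_divisor) linarith
    show i: "(j + 1) mod n = i" unfolding j_def using assms(2) by (intro next_prev_index) (simp add: n_def)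
    have "(j + 2) mod n = ((j + 1) mod n + 1) mod n" by (simp add: mod_simps)
    then show "(j + 2) mod n = (i + 1) mod n" by (simp only: i)
  qed
  show "{vs ! ((i + n - 1) mod n), vs ! i} \<in> E" "{vs ! i, vs ! ((i + 1) mod n)} \<in> E"
    "vs ! ((i + n - 1) mod n) \<noteq> vs ! ((i + 1) mod n)"
    using assms(1,2) j unfolding closed_gpath_def j_def[symmetric] n_def[symmetric] by metis+
qed

lemma exp_half_turn_corner:
  assumes "{p, v} \<in> E" "{v, q} \<in> E" "p \<noteq> q"
  shows "exp (\<i> * complex_of_real (Arg ((pos q - pos v) / (pos v - pos p)) / 2)) =
    corner p v q * exp (\<i> * complex_of_real ((Arg (pos q - pos v) - Arg (pos v - pos p)) / 2))"
proof -
  have E: "(v, p) \<in> halves E" "(p, v) \<in> halves E" "(v, q) \<in> halves E"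
    using assms by (auto simp: insert_commute)
  have ne: "pos q - pos v \<noteq> 0" "pos p - pos v \<noteq> 0"
    using edge_ends[OF assms(1)] edge_ends[OF assms(2)] by auto
  have A: "Arg (pos q - pos v) \<noteq> Arg (pos p - pos v)"
    using Arg_neq[of v p q] assms by (simp add: insert_commute)
  have "turn (v, p) (v, q) = (if Arg (pos p - pos v) < Arg (pos q - pos v) then 1 else -1)"
    using A E by (auto simp: turn_def key_less_iff hless_def)
  moreover have "dirsgn (p, v) = (if upward (pos p - pos v) then -1 else 1)"
    using key_less_iff[OF E(2,1)] upward_minus[OF ne(2)] edge_ends(3)[OF assms(1)]
    by (auto simp: dirsgn_def hless_def below_def)
  ultimately show ?thesis
    using exp_half_turn_angle[OF ne A] unfolding corner_def by simp
qed

lemma loop_sgn_corners: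
  assumes "closed_gpath E vs"
  defines "n \<equiv> length vs"
  shows "loop_sgn pos vs = - (\<Prod>i<n. corner (vs ! ((i + n - 1) mod n)) (vs ! i) (vs ! ((i + 1) mod n)))"
proof -
  define \<theta> where "\<theta> i = Arg (pos (vs ! ((i + 1) mod n)) - pos (vs ! i))" for i
  have exp_sum: "exp (\<i> * complex_of_real ((\<Sum>i<n. g i) / 2)) = (\<Prod>i<n. exp (\<i> * complex_of_real (g i / 2)))" for g
    by (simp add: sum_divide_distrib sum_distrib_left exp_sum)
  have turn: "exp (\<i> * complex_of_real (turn_angle pos vs i / 2)) =
      corner (vs ! ((i + n - 1) mod n)) (vs ! i) (vs ! ((i + 1) mod n)) *
      exp (\<i> * complex_of_real ((\<theta> i - \<theta> ((i + n - 1) mod n)) / 2))"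
    if i: "i < n" for i
  proof -
    have "((i + n - 1) mod n + 1) mod n = i" using i by (rule next_prev_index)
    then show ?thesis
      using exp_half_turn_corner[of "vs ! ((i + n - 1) mod n)" "vs ! i" "vs ! ((i + 1) mod n)"]
        closed_gpath_corner[OF assms(1)] i unfolding n_def
      by (simp add: turn_angle_def Let_def \<theta>_def n_def)
  qed
  \<comment> \<open>The coboundary exponents are differences of consecutive directions, so they
    cancel around the closed walk.\<close>
  have "(\<Sum>i<n. \<theta> ((i + n - 1) mod n)) = (\<Sum>i<n. \<theta> ((((i + 1) mod n) + n - 1) mod n))"
    by (rule sum_next_index[symmetric])
  also have "\<dots> = (\<Sum>i<n. \<theta> i)" by (rule sum.cong) (simp_all only: prev_next_index lessThan_iff)
  finally have "(\<Sum>i<n. \<theta> i - \<theta> ((i + n - 1) mod n)) = 0" by (simp add: sum_subtractf)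
  then have one: "(\<Prod>i<n. exp (\<i> * complex_of_real ((\<theta> i - \<theta> ((i + n - 1) mod n)) / 2))) = 1"
    using exp_sum[of "\<lambda>i. \<theta> i - \<theta> ((i + n - 1) mod n)"] by simp
  have "loop_sgn pos vs = - (\<Prod>i<n. exp (\<i> * complex_of_real (turn_angle pos vs i / 2)))"
    unfolding loop_sgn_def winding_angle_def n_def[symmetric] exp_sum ..
  also have "(\<Prod>i<n. exp (\<i> * complex_of_real (turn_angle pos vs i / 2))) =
    (\<Prod>i<n. corner (vs ! ((i + n - 1) mod n)) (vs ! i) (vs ! ((i + 1) mod n)) *
      exp (\<i> * complex_of_real ((\<theta> i - \<theta> ((i + n - 1) mod n)) / 2)))"
    by (rule prod.cong) (simp_all only: turn lessThan_iff)
  finally show ?thesis by (simp only: prod.distrib one mult_1_right)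
qed

definition steps :: "'v list \<Rightarrow> ('v \<times> 'v) list" where
  "steps vs = map (\<lambda>i. (vs ! i, vs ! ((i + 1) mod length vs))) [0..<length vs]"

lemma walk_weight_cycle:
  assumes "closed_gpath E vs"
  shows "walk_weight vs = - cycle_weight (steps vs)"
proof -
  define n where "n = length vs"
  have npos: "0 < n" using assms by (simp add: closed_gpath_def n_def)
  have "(\<Prod>i<n. corner (vs ! ((i + n - 1) mod n)) (vs ! i) (vs ! ((i + 1) mod n))) =
      (\<Prod>i<n. corner (vs ! (((i + 1) mod n + n - 1) mod n)) (vs ! ((i + 1) mod n)) (vs ! (((i + 1) mod n + 1) mod n)))"
    by (rule prod_next_index[symmetric])
  also have "\<dots> = (\<Prod>i<n. corner (vs ! i) (vs ! ((i + 1) mod n)) (vs ! (((i + 1) mod n + 1) mod n)))"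
    by (rule prod.cong) (simp_all only: prev_next_index lessThan_iff)
  finally have "walk_weight vs = - (\<Prod>i<n. corner (vs ! i) (vs ! ((i + 1) mod n)) (vs ! (((i + 1) mod n + 1) mod n)) *
      x {vs ! i, vs ! ((i + 1) mod n)})"
    unfolding walk_weight_def using loop_sgn_corners[OF assms] by (simp add: n_def prod.distrib)
  also have "\<dots> = - cycle_weight (steps vs)"
    unfolding cycle_weight_def steps_def n_def[symmetric]
    using npos by (simp add: corner_def edge_def mult_ac)
  finally show ?thesis .
qed

text \<open>Unless each half-edge starts where its predecessor ends and is not the reversal of it,
  some \<open>turn\<close> factor vanishes. The remaining lists are the step lists of closed
  walks.\<close>

lemma cycle_weight_trace:
  assumes n: "0 < n"
  shows "- (\<Sum>ds | set ds \<subseteq> halves E \<and> length ds = n. cycle_weight ds) =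
    (\<Sum>vs | closed_gpath E vs \<and> length vs = n. walk_weight vs)"
proof -
  let ?G = "{ds. set ds \<subseteq> halves E \<and> length ds = n \<and>
    (\<forall>i<n. fst (ds ! ((i + 1) mod n)) = snd (ds ! i) \<and> ds ! ((i + 1) mod n) \<noteq> prod.swap (ds ! i))}"
  have fin: "finite {ds. set ds \<subseteq> halves E \<and> length ds = n}"
    by (rule finite_lists_length_eq) (simp add: finite_halves)
  have "(\<Sum>ds | set ds \<subseteq> halves E \<and> length ds = n. cycle_weight ds) = (\<Sum>ds\<in>?G. cycle_weight ds)"
  proof (rule sum.mono_neutral_right[OF fin])
    show "\<forall>ds\<in>{ds. set ds \<subseteq> halves E \<and> length ds = n} - ?G. cycle_weight ds = 0"
    proof
      fix ds assume "ds \<in> {ds. set ds \<subseteq> halves E \<and> length ds = n} - ?G"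
      then obtain i where i: "length ds = n" "i < n"
        "fst (ds ! ((i + 1) mod n)) \<noteq> snd (ds ! i) \<or> ds ! ((i + 1) mod n) = prod.swap (ds ! i)"
        by blast
      then have "turn (prod.swap (ds ! i)) (ds ! ((i + 1) mod n)) = 0"
        by (auto simp: turn_def)
      then show "cycle_weight ds = 0"
        unfolding cycle_weight_def using i by (intro prod_zero) auto
    qed
  qed auto
  also have "\<dots> = (\<Sum>vs | closed_gpath E vs \<and> length vs = n. - walk_weight vs)"
  proof (rule sum.reindex_bij_witness[of _ steps "map fst"])
    fix ds assume "ds \<in> ?G"
    then have ds: "set ds \<subseteq> halves E" "length ds = n"
      "\<And>i. i < n \<Longrightarrow> fst (ds ! ((i + 1) mod n)) = snd (ds ! i)"
      "\<And>i. i < n \<Longrightarrow> ds ! ((i + 1) mod n) \<noteq> prod.swap (ds ! i)" by auto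
    have lt: "(i + 1) mod n < n" "(i + 2) mod n < n" for i using n by simp_all
    have nth: "map fst ds ! ((i + 1) mod n) = snd (ds ! i)" if "i < n" for i
      using that ds lt(1)[of i] by simp
    show steps: "steps (map fst ds) = ds"
      by (rule nth_equalityI) (use ds nth in \<open>auto simp: steps_def\<close>)
    have cl: "closed_gpath E (map fst ds)"
      unfolding closed_gpath_def
    proof (intro conjI allI impI)
      show "map fst ds \<noteq> []" using ds(2) n by auto
    next
      fix i assume "i < length (map fst ds)"
      then have i: "i < n" using ds(2) by simp
      have "ds ! i \<in> halves E" using ds i by auto
      then show "{map fst ds ! i, map fst ds ! ((i + 1) mod length (map fst ds))} \<in> E"
        using nth[OF i] ds(2) i by (simp add: halves_def case_prod_unfold)
      have e: "((i + 1) mod n + 1) mod n = (i + 2) mod n" by (simp add: mod_simps)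
      have "map fst ds ! ((i + 2) mod n) = snd (ds ! ((i + 1) mod n))"
        using nth[OF lt(1)[of i]] unfolding e .
      moreover have "snd (ds ! ((i + 1) mod n)) \<noteq> fst (ds ! i)"
        using ds(3)[OF i] ds(4)[OF i] by (auto simp: prod_eq_iff)
      ultimately show "map fst ds ! ((i + 2) mod length (map fst ds)) \<noteq> map fst ds ! i"
        using ds(2) i by simp
    qed
    then show "map fst ds \<in> {vs. closed_gpath E vs \<and> length vs = n}" using ds(2) by simp
    show "- walk_weight (map fst ds) = cycle_weight ds"
      using walk_weight_cycle[OF cl] steps by simp
  next
    fix vs assume "vs \<in> {vs. closed_gpath E vs \<and> length vs = n}"
    then have vs: "closed_gpath E vs" "length vs = n" by auto
    show "map fst (steps vs) = vs"
      by (rule nth_equalityI) (auto simp: steps_def)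
    have nth: "steps vs ! i = (vs ! i, vs ! ((i + 1) mod n))" if "i < n" for i
      using that vs(2) by (simp add: steps_def)
    have "steps vs ! ((i + 1) mod n) \<noteq> prod.swap (steps vs ! i)" if i: "i < n" for i
    proof -
      have "(i + 1) mod n < n" "((i + 1) mod n + 1) mod n = (i + 2) mod n" using n by (simp_all add: mod_simps)
      then show ?thesis using vs i nth unfolding closed_gpath_def by simp
    qed
    moreover have "fst (steps vs ! ((i + 1) mod n)) = snd (steps vs ! i)" if "i < n" for i
      using that n nth by simp
    moreover have "set (steps vs) \<subseteq> halves E"
      using vs unfolding closed_gpath_def by (auto simp: steps_def)
    moreover have "length (steps vs) = n" using vs(2) by (simp add: steps_def)
    ultimately show "steps vs \<in> ?G" by blast
  qed
  finally show ?thesis by (simp add: sum_negf)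
qed

lemma even_subgraph_recursion:
  "2 * of_nat (Suc n) * part (Suc n) =
    (\<Sum>k\<le>n. part (n - k) * (\<Sum>vs | closed_gpath E vs \<and> length vs = Suc k. walk_weight vs))"
  unfolding part_recursion by (simp only: cycle_weight_trace zero_less_Suc)

lemma walk_weight_corners:
  assumes "closed_gpath E vs"
  defines "n \<equiv> length vs"
  shows "walk_weight vs = - (\<Prod>i<n. corner (vs ! ((i + n - 1) mod n)) (vs ! i) (vs ! ((i + 1) mod n))) *
     (\<Prod>i<n. x {vs ! i, vs ! ((i + 1) mod n)})"
  using loop_sgn_corners[OF assms(1)] by (simp add: walk_weight_def n_def)

end

lemma prod_prev_index:
  "(\<Prod>i<m. f ((i + m - 1) mod m) i) = (\<Prod>i<m. f i ((i + 1) mod m))" for m :: nat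
proof -
  have "(\<Prod>i<m. f ((i + m - 1) mod m) i) = (\<Prod>i<m. f (((i + 1) mod m + m - 1) mod m) ((i + 1) mod m))"
    by (rule prod_next_index[symmetric])
  also have "\<dots> = (\<Prod>i<m. f i ((i + 1) mod m))"
    by (rule prod.cong) (simp_all only: prev_next_index lessThan_iff)
  finally show ?thesis .
qed

lemma reflect_next_index:
  fixes n k :: nat
  assumes "k < n"
  shows "(n - 1 - (k + 1) mod n + 1) mod n = n - 1 - k"
  unfolding next_index[OF assms] using assms by auto

lemma reflect_prev_index:
  fixes n k :: nat
  assumes "k < n"
  shows "(n - 1 - k + 1) mod n = n - 1 - (k + n - 1) mod n"
  unfolding prev_index[OF assms] using assms by auto

lemma prod_reflect_index: "(\<Prod>i<n. f (n - 1 - i)) = (\<Prod>i<n. f i)" for n :: nat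
  by (rule prod.reindex_bij_witness[of _ "\<lambda>i. n - 1 - i" "\<lambda>i. n - 1 - i"]) auto

lemma closed_gpath_rotate1:
  assumes "closed_gpath E vs"
  shows "closed_gpath E (rotate1 vs)"
proof -
  define n where "n = length vs"
  have n: "0 < n" using assms by (simp add: closed_gpath_def n_def)
  have C: "{vs ! i, vs ! ((i + 1) mod n)} \<in> E \<and> vs ! ((i + 2) mod n) \<noteq> vs ! i" if "i < n" for i
    using assms that unfolding closed_gpath_def n_def by blast
  have nth: "rotate1 vs ! i = vs ! ((i + 1) mod n)" if "i < n" for i
    using that nth_rotate1[of i vs] by (simp add: n_def)
  have "{rotate1 vs ! i, rotate1 vs ! ((i + 1) mod n)} \<in> E \<and> rotate1 vs ! ((i + 2) mod n) \<noteq> rotate1 vs ! i"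
    if i: "i < n" for i
  proof -
    have e: "((i + 2) mod n + 1) mod n = ((i + 1) mod n + 2) mod n" by (simp add: mod_simps)
    have "(i + 1) mod n < n" "(i + 2) mod n < n" using n by simp_all
    then show ?thesis using C[of "(i + 1) mod n"] unfolding nth[OF i] nth[OF \<open>(i + 1) mod n < n\<close>] nth[OF \<open>(i + 2) mod n < n\<close>] e by blast
  qed
  then show ?thesis using assms unfolding closed_gpath_def by (simp add: n_def)
qed

lemma closed_gpath_rev:
  assumes "closed_gpath E vs"
  shows "closed_gpath E (rev vs)"
proof -
  define n where "n = length vs"
  have n: "0 < n" using assms by (simp add: closed_gpath_def n_def)
  have C: "{vs ! i, vs ! ((i + 1) mod n)} \<in> E \<and> vs ! ((i + 2) mod n) \<noteq> vs ! i" if "i < n" for i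
    using assms that unfolding closed_gpath_def n_def by blast
  have nth: "rev vs ! i = vs ! (n - 1 - i)" if "i < n" for i
    using that rev_nth[of i vs] by (simp add: n_def)
  have "{rev vs ! i, rev vs ! ((i + 1) mod n)} \<in> E \<and> rev vs ! ((i + 2) mod n) \<noteq> rev vs ! i"
    if i: "i < n" for i
  proof -
    have lt: "(i + 1) mod n < n" "(i + 2) mod n < n" using n by simp_all
    have e: "((i + 1) mod n + 1) mod n = (i + 2) mod n" by (simp add: mod_simps)
    define j where "j = n - 1 - (i + 2) mod n"
    define k where "k = n - 1 - (i + 1) mod n"
    have j1: "(j + 1) mod n = k"
      using reflect_next_index[OF lt(1)] unfolding e j_def k_def .
    have k1: "(k + 1) mod n = n - 1 - i"
      using reflect_next_index[OF i] unfolding k_def .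
    have "(j + 2) mod n = ((j + 1) mod n + 1) mod n" by (simp add: mod_simps)
    then have j2: "(j + 2) mod n = n - 1 - i" by (simp only: j1 k1)
    have "j < n" "k < n" using n by (simp_all add: j_def k_def)
    then have "{vs ! k, vs ! (n - 1 - i)} \<in> E" "vs ! (n - 1 - i) \<noteq> vs ! j"
      using C[of j] C[of k] j2 k1 by auto
    then show ?thesis
      using nth[OF i] nth[OF lt(1)] nth[OF lt(2)] by (simp add: insert_commute j_def k_def)
  qed
  then show ?thesis using assms unfolding closed_gpath_def by (simp add: n_def)
qed

context plane_drawing
begin

lemma turn_commute: "turn b a = - turn a b"
  by (auto simp: turn_def)

text \<open>Under reversal both \<open>dirsgn\<close> and \<open>turn\<close> change sign, and the
  signs cancel. Compared with \<open>corner p v q\<close>, only the \<open>dirsgn\<close> of the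
  incoming step is replaced by that of the outgoing one, which a cyclic shift repairs in
  \<open>walk_weight_rev\<close>.\<close>

lemma corner_reverse:
  assumes "{p, v} \<in> E" "{v, q} \<in> E"
  shows "corner q v p = dirsgn (v, q) * turn (v, p) (v, q)"
  using turn_commute[of "(v, q)" "(v, p)"] dirsgn_bar[of "(v, q)"] assms by (simp add: corner_def)

lemma walk_weight_rotate1:
  assumes "closed_gpath E vs"
  shows "walk_weight (rotate1 vs) = walk_weight vs"
proof -
  define n where "n = length vs"
  have n: "0 < n" using assms by (simp add: closed_gpath_def n_def)
  have nth: "rotate1 vs ! i = vs ! ((i + 1) mod n)" if "i < n" for i
    using that nth_rotate1[of i vs] by (simp add: n_def)
  have "(\<Prod>i<n. corner (rotate1 vs ! ((i + n - 1) mod n)) (rotate1 vs ! i) (rotate1 vs ! ((i + 1) mod n))) =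
      (\<Prod>i<n. corner (vs ! (((i + 1) mod n + n - 1) mod n)) (vs ! ((i + 1) mod n)) (vs ! (((i + 1) mod n + 1) mod n)))"
  proof (rule prod.cong)
    fix i assume "i \<in> {..<n}"
    then have i: "i < n" by simp
    have lt: "(i + n - 1) mod n < n" "(i + 1) mod n < n" using n by simp_all
    show "corner (rotate1 vs ! ((i + n - 1) mod n)) (rotate1 vs ! i) (rotate1 vs ! ((i + 1) mod n)) =
      corner (vs ! (((i + 1) mod n + n - 1) mod n)) (vs ! ((i + 1) mod n)) (vs ! (((i + 1) mod n + 1) mod n))"
      by (simp only: nth i lt next_prev_index prev_next_index)
  qed simp
  also have "\<dots> = (\<Prod>i<n. corner (vs ! ((i + n - 1) mod n)) (vs ! i) (vs ! ((i + 1) mod n)))"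
    by (rule prod_next_index)
  finally have c: "(\<Prod>i<n. corner (rotate1 vs ! ((i + n - 1) mod n)) (rotate1 vs ! i) (rotate1 vs ! ((i + 1) mod n))) = \<dots>" .
  have "(\<Prod>i<n. x {rotate1 vs ! i, rotate1 vs ! ((i + 1) mod n)}) =
      (\<Prod>i<n. x {vs ! ((i + 1) mod n), vs ! (((i + 1) mod n + 1) mod n)})"
    using n by (intro prod.cong refl) (simp add: nth)
  also have "\<dots> = (\<Prod>i<n. x {vs ! i, vs ! ((i + 1) mod n)})" by (rule prod_next_index)
  finally show ?thesis
    using c walk_weight_corners[OF assms] walk_weight_corners[OF closed_gpath_rotate1[OF assms]]
    by (simp only: length_rotate1 n_def)
qed

lemma walk_weight_rev:
  assumes "closed_gpath E vs"
  shows "walk_weight (rev vs) = walk_weight vs"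
proof -
  define n where "n = length vs"
  have n: "0 < n" using assms by (simp add: closed_gpath_def n_def)
  have nth: "rev vs ! i = vs ! (n - 1 - i)" if "i < n" for i
    using that rev_nth[of i vs] by (simp add: n_def)
  have rprev: "rev vs ! ((i + n - 1) mod n) = vs ! ((n - 1 - i + 1) mod n)" if "i < n" for i
    using nth[of "(i + n - 1) mod n"] n reflect_prev_index[OF that] by simp
  have rnext: "rev vs ! ((i + 1) mod n) = vs ! ((n - 1 - i + n - 1) mod n)" if "i < n" for i
  proof -
    have lt: "(i + 1) mod n < n" "n - 1 - (i + 1) mod n < n" using n by simp_all
    have "(n - 1 - i + n - 1) mod n = n - 1 - (i + 1) mod n"
      using prev_next_index[OF lt(2)] unfolding reflect_next_index[OF that] .
    then show ?thesis by (simp only: nth[OF lt(1)])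
  qed
  have C: "{vs ! ((i + n - 1) mod n), vs ! i} \<in> E" "{vs ! i, vs ! ((i + 1) mod n)} \<in> E" if "i < n" for i
    using closed_gpath_corner[OF assms] that by (simp_all only: n_def)
  have "(\<Prod>i<n. corner (rev vs ! ((i + n - 1) mod n)) (rev vs ! i) (rev vs ! ((i + 1) mod n))) =
      (\<Prod>i<n. corner (vs ! ((n - 1 - i + 1) mod n)) (vs ! (n - 1 - i)) (vs ! ((n - 1 - i + n - 1) mod n)))"
    by (rule prod.cong) (simp_all only: rprev rnext nth lessThan_iff)
  also have "\<dots> = (\<Prod>i<n. corner (vs ! ((i + 1) mod n)) (vs ! i) (vs ! ((i + n - 1) mod n)))"
    by (rule prod_reflect_index)
  also have "\<dots> = (\<Prod>i<n. dirsgn (vs ! i, vs ! ((i + 1) mod n)) *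
      turn (vs ! i, vs ! ((i + n - 1) mod n)) (vs ! i, vs ! ((i + 1) mod n)))"
    by (rule prod.cong) (simp_all only: corner_reverse C lessThan_iff)
  also have "\<dots> = (\<Prod>i<n. dirsgn (vs ! ((i + n - 1) mod n), vs ! i) *
      turn (vs ! i, vs ! ((i + n - 1) mod n)) (vs ! i, vs ! ((i + 1) mod n)))"
    unfolding prod.distrib using prod_prev_index[of "\<lambda>i j. dirsgn (vs ! i, vs ! j)" n] by simp
  finally have c: "(\<Prod>i<n. corner (rev vs ! ((i + n - 1) mod n)) (rev vs ! i) (rev vs ! ((i + 1) mod n))) =
      (\<Prod>i<n. corner (vs ! ((i + n - 1) mod n)) (vs ! i) (vs ! ((i + 1) mod n)))"
    unfolding corner_def .
  have "(\<Prod>i<n. x {rev vs ! i, rev vs ! ((i + 1) mod n)}) =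
      (\<Prod>i<n. x {vs ! (n - 1 - i), vs ! ((n - 1 - i + n - 1) mod n)})"
    by (rule prod.cong) (simp_all only: rnext nth lessThan_iff)
  also have "\<dots> = (\<Prod>i<n. x {vs ! i, vs ! ((i + n - 1) mod n)})"
    by (rule prod_reflect_index)
  also have "\<dots> = (\<Prod>i<n. x {vs ! i, vs ! ((i + 1) mod n)})"
    using prod_prev_index[of "\<lambda>i j. x {vs ! i, vs ! j}" n] by (simp add: insert_commute)
  finally show ?thesis
    using c walk_weight_corners[OF assms] walk_weight_corners[OF closed_gpath_rev[OF assms]]
    by (simp only: length_rev n_def)
qed

end

section \<open>Loops as dihedral orbits of closed walks\<close>

lemma lex_le_refl: "lex_le xs xs"
  by (simp add: lex_le_def)

lemma trans_less_pairs: "trans {(a::'a::linorder, b). a < b}"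
  by (rule transI) auto

lemma lex_le_trans: "lex_le xs ys \<Longrightarrow> lex_le ys zs \<Longrightarrow> lex_le xs zs"
  using lexord_trans[OF _ _ trans_less_pairs] by (auto simp: lex_le_def)

lemma lex_le_linear: "lex_le (xs :: 'a::linorder list) ys \<or> lex_le ys xs"
proof -
  have "\<forall>a b :: 'a. (a, b) \<in> {(a, b). a < b} \<or> a = b \<or> (b, a) \<in> {(a, b). a < b}" by auto
  from lexord_linear[OF this] show ?thesis by (auto simp: lex_le_def)
qed

lemma lex_le_antisym:
  assumes "lex_le xs ys" "lex_le ys xs"
  shows "xs = ys"
proof (rule ccontr)
  assume "xs \<noteq> ys"
  then have "(xs, xs) \<in> lexord {(a, b). a < b}"
    using assms lexord_trans[OF _ _ trans_less_pairs] by (auto simp: lex_le_def)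
  moreover have "(xs, xs) \<notin> lexord {(a, b). a < b}" by (rule lexord_irreflexive) auto
  ultimately show False by blast
qed

lemma lex_le_min_exists:
  assumes "finite S" "S \<noteq> {}"
  shows "\<exists>m\<in>S. \<forall>ys\<in>S. lex_le m ys"
  using assms
proof (induction S rule: finite_ne_induct)
  case (singleton xs)
  then show ?case by (simp add: lex_le_refl)
next
  case (insert xs S)
  then obtain m where m: "m \<in> S" "\<forall>ys\<in>S. lex_le m ys" by blast
  consider "lex_le xs m" | "lex_le m xs" using lex_le_linear by blast
  then show ?case
    using m lex_le_trans lex_le_refl by cases blast+
qed

definition dihedral_orbit :: "'a list \<Rightarrow> 'a list set" where
  "dihedral_orbit xs = range (\<lambda>k. rotate k xs) \<union> range (\<lambda>k. rotate k (rev xs))"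

lemma rotate_in_range: "range (\<lambda>k. rotate k (rotate j xs)) = range (\<lambda>k. rotate k xs)"
proof
  show "range (\<lambda>k. rotate k (rotate j xs)) \<subseteq> range (\<lambda>k. rotate k xs)"
    by (auto simp: rotate_rotate)
  show "range (\<lambda>k. rotate k xs) \<subseteq> range (\<lambda>k. rotate k (rotate j xs))"
  proof
    fix ys assume "ys \<in> range (\<lambda>k. rotate k xs)"
    then obtain k where "ys = rotate k xs" by auto
    \<comment> \<open>Adding a multiple of the length changes nothing, and rotating by
      \<open>j * (length xs - 1)\<close> undoes the rotation by \<open>j\<close>.\<close>
    also have "\<dots> = rotate (k + j * length xs) xs"
      using rotate_conv_mod[of k xs] rotate_conv_mod[of "k + j * length xs" xs] by simp
    also have "\<dots> = rotate (k + j * (length xs - 1)) (rotate j xs)"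
    proof (cases "length xs")
      case 0
      then show ?thesis by simp
    next
      case (Suc n)
      then show ?thesis by (simp add: rotate_rotate algebra_simps)
    qed
    finally show "ys \<in> range (\<lambda>k. rotate k (rotate j xs))" by blast
  qed
qed

lemma rev_rotate_range: "range (\<lambda>k. rotate k (rev (rotate j xs))) = range (\<lambda>k. rotate k (rev xs))"
proof -
  obtain i where "rev (rotate j xs) = rotate i (rev xs)"
  proof
    have "rotate (length xs - j mod length xs) (rev xs) = rev (rotate (length xs - (length xs - j mod length xs) mod length xs) xs)"
      using rotate_rev[of "length xs - j mod length xs" xs] by simp
    also have "rotate (length xs - (length xs - j mod length xs) mod length xs) xs = rotate j xs"
    proof (cases "xs = [] \<or> j mod length xs = 0")
      case True
      then show ?thesis using rotate_conv_mod[of j xs] by auto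
    next
      case False
      then have "0 < j mod length xs" "j mod length xs < length xs" by auto
      then have "length xs - (length xs - j mod length xs) mod length xs = j mod length xs" by simp
      then show ?thesis using rotate_conv_mod[of j xs] by simp
    qed
    finally show "rev (rotate j xs) = rotate (length xs - j mod length xs) (rev xs)" ..
  qed
  then show ?thesis by (simp add: rotate_in_range)
qed

lemma dihedral_orbit_eq:
  assumes "ys \<in> dihedral_orbit xs"
  shows "dihedral_orbit ys = dihedral_orbit xs"
proof -
  have r: "dihedral_orbit (rotate j zs) = dihedral_orbit zs" for j and zs :: "'a list"
    by (simp add: dihedral_orbit_def rotate_in_range rev_rotate_range)
  have "dihedral_orbit (rev zs) = dihedral_orbit zs" for zs :: "'a list"
    by (auto simp: dihedral_orbit_def)
  moreover obtain k where "ys = rotate k xs \<or> ys = rotate k (rev xs)"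
    using assms by (auto simp: dihedral_orbit_def)
  ultimately show ?thesis using r by auto
qed

lemma self_in_orbit: "xs \<in> dihedral_orbit xs"
  using range_eqI[of xs "\<lambda>k. rotate k xs" 0] by (simp add: dihedral_orbit_def)

lemma length_orbit: "ys \<in> dihedral_orbit xs \<Longrightarrow> length ys = length xs"
  by (auto simp: dihedral_orbit_def)

lemma rotate_inj: "rotate k xs = rotate k ys \<Longrightarrow> length xs = length ys \<Longrightarrow> xs = ys"
proof -
  assume eq: "rotate k xs = rotate k ys" and len: "length xs = length ys"
  let ?j = "length xs - k mod length xs"
  have undo: "rotate (length zs - k mod length zs) (rotate k zs) = zs" for zs :: "'a list"
  proof (cases "zs = []")
    case False
    have "rotate (length zs - k mod length zs) (rotate k zs) =
        rotate (length zs - k mod length zs) (rotate (k mod length zs) zs)"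
      using rotate_conv_mod[of k zs] by simp
    also have "\<dots> = rotate (length zs) zs" using False by (simp add: rotate_rotate)
    finally show ?thesis by simp
  qed simp
  show ?thesis using undo[of xs] undo[of ys] eq len by metis
qed

definition list_period :: "'a list \<Rightarrow> nat" where
  "list_period xs = (LEAST p. 0 < p \<and> rotate p xs = xs)"

lemma list_period:
  assumes "xs \<noteq> []"
  shows "0 < list_period xs" "rotate (list_period xs) xs = xs"
    "rotate q xs = xs \<Longrightarrow> list_period xs dvd q"
    "card (range (\<lambda>k. rotate k xs)) = list_period xs"
proof -
  let ?p = "list_period xs"
  have "0 < length xs \<and> rotate (length xs) xs = xs" using assms by simp
  then have "0 < ?p \<and> rotate ?p xs = xs" unfolding list_period_def by (rule LeastI)
  then show p: "0 < ?p" "rotate ?p xs = xs" by simp_all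
  have least: "?p \<le> q" if "0 < q" "rotate q xs = xs" for q
    unfolding list_period_def using that by (intro Least_le) simp
  have mult: "rotate (j * ?p) xs = xs" for j
    by (induction j) (simp_all add: rotate_rotate[symmetric] p)
  have modp: "rotate q xs = rotate (q mod ?p) xs" for q
  proof -
    have "rotate q xs = rotate (q mod ?p) (rotate (q div ?p * ?p) xs)"
      by (simp add: rotate_rotate)
    then show ?thesis by (simp add: mult)
  qed
  show "?p dvd q" if "rotate q xs = xs" for q
    using least[of "q mod ?p"] modp[of q] that p(1) by (metis dvd_eq_mod_eq_0 leD mod_less_divisor not_gr_zero)
  have "range (\<lambda>k. rotate k xs) = (\<lambda>k. rotate k xs) ` {..<?p}"
  proof (intro equalityI subsetI)
    fix ys assume "ys \<in> range (\<lambda>k. rotate k xs)"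
    then obtain k where "ys = rotate k xs" by auto
    then have "ys = rotate (k mod ?p) xs" using modp by simp
    then show "ys \<in> (\<lambda>k. rotate k xs) ` {..<?p}" using p(1) by (intro image_eqI[of _ _ "k mod ?p"]) auto
  qed auto
  moreover have "inj_on (\<lambda>k. rotate k xs) {..<?p}"
  proof -
    have False if "i < j" "j < ?p" "rotate i xs = rotate j xs" for i j
    proof -
      have "rotate i (rotate (j - i) xs) = rotate i xs" using that by (simp add: rotate_rotate)
      then have "rotate (j - i) xs = xs" by (rule rotate_inj) simp
      then show False using least[of "j - i"] that by simp
    qed
    then show ?thesis by (metis inj_onI lessThan_iff linorder_neqE_nat)
  qed
  ultimately show "card (range (\<lambda>k. rotate k xs)) = ?p" by (simp add: card_image)
qed

text \<open>A reflection of a cycle reverses some edge or fixes some vertex, which would force a self-loop or a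
  backtracking step.\<close>

lemma closed_gpath_rotate_neq_rev:
  assumes vs: "closed_gpath E vs" and noloop: "\<And>v. {v} \<notin> E"
  shows "rotate k vs \<noteq> rev vs"
proof
  assume eq: "rotate k vs = rev vs"
  define n where "n = length vs"
  have n: "0 < n" using vs by (simp add: closed_gpath_def n_def)
  define j where "j = k mod n"
  have j: "j < n" using n by (simp add: j_def)
  have sym: "vs ! ((j + i) mod n) = vs ! (n - 1 - i)" if "i < n" for i
  proof -
    have "vs ! ((k + i) mod n) = rev vs ! i"
      using that nth_rotate[of i vs k] eq by (simp add: n_def)
    then show ?thesis using that rev_nth[of i vs] by (simp add: n_def j_def mod_simps)
  qed
  have adj: "vs ! ((a + 1) mod n) \<noteq> vs ! a" "vs ! ((a + 2) mod n) \<noteq> vs ! a" if "a < n" for a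
    using vs noloop[of "vs ! a"] that unfolding closed_gpath_def n_def by (metis insert_absorb2)+
  \<comment> \<open>\<open>sym\<close> equates the entries at positions \<open>j + i\<close> and
    \<open>n - 1 - i\<close>, which are \<open>s - 2 * i\<close> apart. So \<open>i\<close> is
    chosen to make the gap 1 (a self-loop) or 2 (a backtracking step); for \<open>s = 0\<close> the
    choice \<open>i = n - 1\<close> gives gap 2 modulo \<open>n\<close>.\<close>
  define s where "s = n - 1 - j"
  consider i where "s = 2 * i + 1" | i where "s = 2 * i + 2" | "s = 0"
  proof (cases "s = 0 \<or> odd s")
    case False
    then have "s = 2 * (s div 2 - 1) + 2" by (auto elim!: evenE)
    then show ?thesis using that by blast
  qed (use that in \<open>auto elim!: oddE\<close>)
  then show False
  proof cases
    case (1 i)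
    then have "j + i = n - 2 - i" "i < n" "n - 2 - i < n" "n - 2 - i + 1 = n - 1 - i"
      using j by (auto simp: s_def)
    then show False using sym[of i] adj(1)[of "n - 2 - i"] by simp
  next
    case (2 i)
    then have "j + i = n - 3 - i" "i < n" "n - 3 - i < n" "n - 3 - i + 2 = n - 1 - i" "n - 1 - i < n"
      using j by (auto simp: s_def)
    then show False using sym[of i] adj(2)[of "n - 3 - i"] by simp
  next
    case 3
    then have "j = n - 1" using j by (simp add: s_def)
    moreover have "((n - 1 + (n - 1)) mod n + 2) mod n = 0"
    proof -
      have "((n - 1 + (n - 1)) mod n + 2) mod n = (n - 1 + (n - 1) + 2) mod n" by (simp only: mod_simps)
      also have "n - 1 + (n - 1) + 2 = 2 * n" using n by simp
      finally show ?thesis by simp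
    qed
    ultimately show False
      using sym[of "n - 1"] adj(2)[of "(n - 1 + (n - 1)) mod n"] n by simp
  qed
qed

lemma card_dihedral_orbit:
  assumes vs: "closed_gpath E vs" and noloop: "\<And>v. {v} \<notin> E"
  shows "finite (dihedral_orbit vs)" "card (dihedral_orbit vs) = 2 * list_period vs"
proof -
  let ?A = "range (\<lambda>k. rotate k vs)" and ?B = "range (\<lambda>k. rotate k (rev vs))"
  have ne: "vs \<noteq> []" using vs by (simp add: closed_gpath_def)
  have A: "card ?A = list_period vs" using list_period(4)[OF ne] .
  then have finA: "finite ?A" using list_period(1)[OF ne] card_ge_0_finite by metis
  have B: "?B = rev ` ?A"
  proof
    show "?B \<subseteq> rev ` ?A"
    proof
      fix ys assume "ys \<in> ?B"
      then obtain k where "ys = rotate k (rev vs)" by auto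
      then have "ys = rev (rotate (length vs - k mod length vs) vs)" using rotate_rev by metis
      then show "ys \<in> rev ` ?A" by blast
    qed
    show "rev ` ?A \<subseteq> ?B"
    proof
      fix ys assume "ys \<in> rev ` ?A"
      then obtain k where ys: "ys = rev (rotate k vs)" by auto
      have "rotate 0 ys \<in> range (\<lambda>i. rotate i (rev (rotate k vs)))" unfolding ys by blast
      then show "ys \<in> ?B" unfolding rev_rotate_range by simp
    qed
  qed
  have "?A \<inter> ?B = {}"
  proof (rule ccontr)
    assume "?A \<inter> ?B \<noteq> {}"
    then obtain a b where ab: "rotate a vs = rotate b (rev vs)" by blast
    have "rotate 0 (rev vs) \<in> range (\<lambda>k. rotate k (rotate b (rev vs)))"
      unfolding rotate_in_range by blast
    then have "rev vs \<in> ?A" unfolding ab[symmetric] rotate_in_range by simp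
    then show False using closed_gpath_rotate_neq_rev[OF assms] by (metis imageE)
  qed
  moreover have "card ?B = card ?A" "finite ?B" unfolding B using finA by (simp_all add: card_image)
  ultimately show "finite (dihedral_orbit vs)" "card (dihedral_orbit vs) = 2 * list_period vs"
    using A finA by (simp_all add: dihedral_orbit_def card_Un_disjoint)
qed

lemma closed_gpath_orbit:
  assumes "closed_gpath E vs" "ys \<in> dihedral_orbit vs"
    and rot: "\<And>zs. closed_gpath E zs \<Longrightarrow> W (rotate1 zs) = W zs"
    and rev: "\<And>zs. closed_gpath E zs \<Longrightarrow> W (rev zs) = W zs"
  shows "closed_gpath E ys \<and> W ys = W vs"
proof -
  have rotk: "closed_gpath E (rotate k zs) \<and> W (rotate k zs) = W zs" if "closed_gpath E zs" for k zs
    by (induction k) (use that rot closed_gpath_rotate1 in \<open>auto simp del: rotate1.simps\<close>)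
  have "closed_gpath E (rev vs) \<and> W (rev vs) = W vs" using assms(1) closed_gpath_rev rev by blast
  then show ?thesis using rotk assms(1,2) unfolding dihedral_orbit_def by (metis (no_types, lifting) Un_iff imageE)
qed

lemma is_gloop_iff:
  "is_gloop E vs \<longleftrightarrow> closed_gpath E vs \<and> (\<forall>ys\<in>dihedral_orbit vs. lex_le vs ys)"
  by (auto simp: is_gloop_def dihedral_orbit_def)

text \<open>Closed walks split into dihedral orbits, each containing exactly one loop, its
  lexicographic minimum. The orbit of \<open>l\<close> has \<open>2 * list_period l\<close>
  elements, and \<open>loop_mult l * list_period l = n\<close>, whence the factor 1 /
  \<open>loop_mult l\<close>.\<close>

lemma sum_gloops:
  fixes W :: "'v::linorder list \<Rightarrow> complex"
  assumes fin: "finite {vs. closed_gpath E vs \<and> length vs = n}" and noloop: "\<And>v. {v} \<notin> E"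
    and rot: "\<And>zs. closed_gpath E zs \<Longrightarrow> W (rotate1 zs) = W zs"
    and rev: "\<And>zs. closed_gpath E zs \<Longrightarrow> W (rev zs) = W zs"
  shows "2 * of_nat n * (\<Sum>l | l \<in> gloops E \<and> length l = n. W l / of_nat (loop_mult l)) =
    (\<Sum>vs | closed_gpath E vs \<and> length vs = n. W vs)"
proof -
  let ?C = "{vs. closed_gpath E vs \<and> length vs = n}"
  let ?G = "{l. l \<in> gloops E \<and> length l = n}"
  have G_C: "?G \<subseteq> ?C" by (auto simp: gloops_def is_gloop_def)
  have C_eq: "?C = (\<Union>l\<in>?G. dihedral_orbit l)"
  proof
    show "(\<Union>l\<in>?G. dihedral_orbit l) \<subseteq> ?C"
      \<comment> \<open>With a constant weight the lemma yields just that the orbit consists of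
        closed walks.\<close>
      using closed_gpath_orbit[of E _ _ "\<lambda>_. ()"] length_orbit G_C by blast
    show "?C \<subseteq> (\<Union>l\<in>?G. dihedral_orbit l)"
    proof
      fix vs assume vs: "vs \<in> ?C"
      then obtain l where l: "l \<in> dihedral_orbit vs" "\<forall>ys\<in>dihedral_orbit vs. lex_le l ys"
        using lex_le_min_exists[of "dihedral_orbit vs"] card_dihedral_orbit(1)[OF _ noloop] self_in_orbit by blast
      have orb: "dihedral_orbit l = dihedral_orbit vs" using l(1) by (rule dihedral_orbit_eq)
      have "closed_gpath E l" using closed_gpath_orbit[of E vs l "\<lambda>_. ()"] vs l by simp
      then have "l \<in> ?G" using l orb vs length_orbit[OF l(1)] by (simp add: gloops_def is_gloop_iff)
      then show "vs \<in> (\<Union>l\<in>?G. dihedral_orbit l)" using orb self_in_orbit by blast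
    qed
  qed
  have "(\<Sum>vs\<in>?C. W vs) = (\<Sum>l\<in>?G. \<Sum>vs\<in>dihedral_orbit l. W vs)"
    unfolding C_eq
  proof (rule sum.UNION_disjoint)
    show "finite ?G" using fin G_C finite_subset by blast
    show "\<forall>l\<in>?G. finite (dihedral_orbit l)" using card_dihedral_orbit(1)[OF _ noloop] G_C by blast
    show "\<forall>l\<in>?G. \<forall>l'\<in>?G. l \<noteq> l' \<longrightarrow> dihedral_orbit l \<inter> dihedral_orbit l' = {}"
    proof (intro ballI impI, rule ccontr)
      fix l l' assume l: "l \<in> ?G" "l' \<in> ?G" "l \<noteq> l'" and "dihedral_orbit l \<inter> dihedral_orbit l' \<noteq> {}"
      then have "dihedral_orbit l = dihedral_orbit l'" using dihedral_orbit_eq by blast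
      then have "lex_le l l'" "lex_le l' l"
        using l self_in_orbit[of l] self_in_orbit[of l'] by (auto simp: gloops_def is_gloop_iff)
      then show False using lex_le_antisym l(3) by blast
    qed
  qed
  also have "\<dots> = (\<Sum>l\<in>?G. 2 * of_nat n * (W l / of_nat (loop_mult l)))"
  proof (rule sum.cong)
    fix l assume l: "l \<in> ?G"
    then have cl: "closed_gpath E l" "length l = n" using G_C by auto
    then have ne: "l \<noteq> []" by (auto simp: closed_gpath_def)
    have dv: "list_period l dvd n" using list_period(3)[OF ne, of n] cl(2) by simp
    have pos: "0 < list_period l" "0 < n" using list_period(1)[OF ne] ne cl(2) by auto
    have mult: "loop_mult l * list_period l = n"
      using dv cl(2) by (simp add: loop_mult_def list_period_def[symmetric])
    then have mpos: "loop_mult l \<noteq> 0" using pos by auto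
    have "(\<Sum>vs\<in>dihedral_orbit l. W vs) = (\<Sum>vs\<in>dihedral_orbit l. W l)"
      using closed_gpath_orbit[OF cl(1) _ rot rev] by (intro sum.cong) auto
    also have "\<dots> = 2 * of_nat (list_period l) * W l"
      using card_dihedral_orbit(2)[OF cl(1) noloop] by simp
    also have "\<dots> = 2 * of_nat n * (W l / of_nat (loop_mult l))"
      using mpos by (simp add: mult[symmetric])
    finally show "(\<Sum>vs\<in>dihedral_orbit l. W vs) = 2 * of_nat n * (W l / of_nat (loop_mult l))" .
  qed simp
  finally show ?thesis by (simp add: sum_distrib_left)
qed

section \<open>Loop configurations\<close>

unbundle no vec_syntax and fps_syntax

text \<open>Splitting off the first loop of a sequence is the Cauchy product with one more
  factor.\<close>

lemma sum_config_fps_power: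
  fixes \<Gamma> :: "'l set" and len :: "'l \<Rightarrow> nat" and w :: "'l \<Rightarrow> complex"
  assumes fin: "\<And>n. finite {l \<in> \<Gamma>. len l = n}"
  defines "conf \<equiv> \<lambda>s n. {c. set c \<subseteq> \<Gamma> \<and> length c = s \<and> sum_list (map len c) = n}"
  shows "finite (conf s n) \<and>
    (\<Sum>c\<in>conf s n. \<Prod>l\<leftarrow>c. w l) = (Abs_fps (\<lambda>n. \<Sum>l\<in>{l \<in> \<Gamma>. len l = n}. w l) ^ s) $ n"
proof (induction s arbitrary: n)
  case 0
  have "conf 0 n = (if n = 0 then {[]} else {})" by (auto simp: conf_def)
  then show ?case by simp
next
  case (Suc s)
  let ?L = "Abs_fps (\<lambda>n. \<Sum>l\<in>{l \<in> \<Gamma>. len l = n}. w l)"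
  let ?S = "SIGMA i:{0..n}. {l \<in> \<Gamma>. len l = i} \<times> conf s (n - i)"
  have S: "finite ?S" using fin Suc by auto
  have bij: "bij_betw (\<lambda>(i, l, c). l # c) ?S (conf (Suc s) n)"
    by (rule bij_betw_byWitness[where f' = "\<lambda>c. (len (hd c), hd c, tl c)"])
      (auto simp: conf_def length_Suc_conv)
  have "(\<Sum>c\<in>conf (Suc s) n. \<Prod>l\<leftarrow>c. w l) = (\<Sum>(i, l, c)\<in>?S. w l * (\<Prod>l\<leftarrow>c. w l))"
    by (subst sum.reindex_bij_betw[OF bij, symmetric]) (simp add: case_prod_unfold)
  also have "\<dots> = (\<Sum>i=0..n. \<Sum>(l, c)\<in>{l \<in> \<Gamma>. len l = i} \<times> conf s (n - i). w l * (\<Prod>l\<leftarrow>c. w l))"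
    by (rule sum.Sigma[symmetric]) (use fin Suc in auto)
  also have "\<dots> = (\<Sum>i=0..n. ?L $ i * (?L ^ s) $ (n - i))"
    unfolding Suc.IH[THEN conjunct2, symmetric]
    by (intro sum.cong refl) (simp add: sum.cartesian_product[symmetric] sum_product)
  also have "\<dots> = (?L ^ Suc s) $ n" by (simp add: fps_mult_nth)
  finally show ?case using S bij bij_betw_finite by blast
qed

text \<open>Positive lengths allow at most \<open>n\<close> loops in total length \<open>n\<close>,
  so there are finitely many configurations and the exponential series stops at \<open>n\<close> as
  well.\<close>

lemma sum_configs_fps_exp:
  fixes \<Gamma> :: "'l set" and len :: "'l \<Rightarrow> nat" and w :: "'l \<Rightarrow> complex"
  assumes fin: "\<And>n. finite {l \<in> \<Gamma>. len l = n}" and pos: "\<And>l. l \<in> \<Gamma> \<Longrightarrow> 0 < len l"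
  defines "conf \<equiv> \<lambda>n. {c. set c \<subseteq> \<Gamma> \<and> sum_list (map len c) = n}"
  shows "finite (conf n)"
    "(\<Sum>c\<in>conf n. 1 / of_nat (fact (length c)) * (\<Prod>l\<leftarrow>c. w l)) =
      (fps_exp 1 oo Abs_fps (\<lambda>n. \<Sum>l\<in>{l \<in> \<Gamma>. len l = n}. w l)) $ n"
proof -
  define conf2 where "conf2 s n = {c. set c \<subseteq> \<Gamma> \<and> length c = s \<and> sum_list (map len c) = n}" for s n
  let ?L = "Abs_fps (\<lambda>n. \<Sum>l\<in>{l \<in> \<Gamma>. len l = n}. w l)"
  note power = sum_config_fps_power[OF fin, where w = w, folded conf2_def]
  have len: "length c \<le> sum_list (map len c)" if "set c \<subseteq> \<Gamma>" for c
    using that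
  proof (induction c)
    case (Cons l c)
    then show ?case using pos[of l] by simp
  qed simp
  have conf_Un: "conf n = (\<Union>s\<in>{0..n}. conf2 s n)"
    using len by (auto simp: conf_def conf2_def)
  then show "finite (conf n)" using power by auto
  have "(\<Sum>c\<in>conf n. 1 / of_nat (fact (length c)) * (\<Prod>l\<leftarrow>c. w l)) =
      (\<Sum>s=0..n. \<Sum>c\<in>conf2 s n. 1 / of_nat (fact (length c)) * (\<Prod>l\<leftarrow>c. w l))"
    unfolding conf_Un by (rule sum.UNION_disjoint) (use power in \<open>auto simp: conf2_def\<close>)
  also have "\<dots> = (\<Sum>s=0..n. (1 / fact s) * (\<Sum>c\<in>conf2 s n. \<Prod>l\<leftarrow>c. w l))"
    unfolding sum_distrib_left by (intro sum.cong refl) (simp add: conf2_def)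
  also have "\<dots> = (fps_exp 1 oo ?L) $ n"
    using power by (simp add: fps_compose_nth)
  finally show "(\<Sum>c\<in>conf n. 1 / of_nat (fact (length c)) * (\<Prod>l\<leftarrow>c. w l)) = (fps_exp 1 oo ?L) $ n" .
qed

text \<open>Coefficientwise, the differential equation of the exponential, Q' = L' Q, is the
  recursion \<open>rec\<close>, which determines everything from the constant term.\<close>

lemma fps_exp_compose_unique:
  fixes L :: "complex fps" and p :: "nat \<Rightarrow> complex"
  assumes L0: "L $ 0 = 0" and p0: "p 0 = 1"
    and rec: "\<And>n. of_nat (Suc n) * p (Suc n) = (\<Sum>k\<le>n. p (n - k) * (of_nat (Suc k) * L $ Suc k))"
  shows "(fps_exp 1 oo L) $ n = p n"
proof (induction n rule: less_induct)
  case (less n)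
  let ?Q = "fps_exp 1 oo L"
  show ?case
  proof (cases n)
    case 0
    then show ?thesis by (simp add: p0 fps_compose_nth)
  next
    case (Suc m)
    have "fps_deriv ?Q = fps_deriv L * ?Q"
      by (simp add: fps_compose_deriv[OF L0] mult.commute)
    then have "fps_deriv ?Q $ m = (fps_deriv L * ?Q) $ m" by simp
    then have "of_nat (Suc m) * ?Q $ Suc m = (\<Sum>k=0..m. of_nat (Suc k) * L $ Suc k * ?Q $ (m - k))"
      by (simp add: fps_mult_nth del: of_nat_Suc)
    also have "\<dots> = (\<Sum>k\<le>m. p (m - k) * (of_nat (Suc k) * L $ Suc k))"
      using less Suc by (intro sum.cong) (auto simp del: of_nat_Suc)
    also have "\<dots> = of_nat (Suc m) * p (Suc m)" by (simp only: rec)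
    finally show ?thesis using Suc by (simp del: of_nat_Suc)
  qed
qed

text \<open>Any \<open>card V\<close> consecutive steps leave the forest: otherwise a closest pair of equal vertices among
  them would close a cycle.\<close>

lemma loop_length_bound:
  fixes V :: "'v set"
  assumes finV: "finite V" and EV: "\<And>a b. {a, b} \<in> E \<Longrightarrow> a \<in> V \<and> a \<noteq> b"
    and acyclic: "acyclic_graph V EA" and vs: "closed_gpath E vs"
  shows "length vs \<le> card V * loop_len EA vs"
proof -
  define n where "n = length vs"
  define N where "N = card V"
  have n: "0 < n" using vs by (simp add: closed_gpath_def n_def)
  have E: "{vs ! i, vs ! ((i + 1) mod n)} \<in> E" and nb: "vs ! ((i + 2) mod n) \<noteq> vs ! i" if "i < n" for i
    using vs that by (auto simp: closed_gpath_def n_def)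
  define I where "I = {i. i < n \<and> {vs ! i, vs ! ((i + 1) mod n)} \<notin> EA}"
  have window: "\<exists>i<N. (j + i) mod n \<in> I" for j
  proof (rule ccontr)
    assume none: "\<not> ?thesis"
    define u where "u i = vs ! ((j + i) mod n)" for i
    have nxt: "vs ! (((j + i) mod n + k) mod n) = u (i + k)" for i k
      by (simp add: u_def mod_simps add.assoc)
    have lt: "(j + i) mod n < n" for i using n by simp
    have uEA: "{u i, u (i + 1)} \<in> EA" if "i < N" for i
      using none that lt[of i] nxt[of i 1] by (auto simp: I_def u_def)
    have uE: "{u i, u (i + 1)} \<in> E" and unb: "u (i + 2) \<noteq> u i" for i
      using E[OF lt[of i]] nb[OF lt[of i]] nxt[of i 1] nxt[of i 2] by (simp_all add: u_def)
    have uV: "u i \<in> V" and une: "u i \<noteq> u (i + 1)" for i using EV uE by blast+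
    \<comment> \<open>A window of \<open>N\<close> steps visits \<open>N + 1\<close> vertices, one
      more than there are.\<close>
    have "card (u ` {..N}) \<le> N" unfolding N_def using finV uV by (intro card_mono) auto
    then have "\<not> inj_on u {..N}" using pigeonhole[of u "{..N}"] by simp
    then have ex: "\<exists>d. 0 < d \<and> (\<exists>i. i + d \<le> N \<and> u i = u (i + d))"
    proof -
      obtain a b where "a \<le> N" "b \<le> N" "u a = u b" "a \<noteq> b"
        using \<open>\<not> inj_on u {..N}\<close> by (auto simp: inj_on_def)
      then have "0 < max a b - min a b \<and> min a b + (max a b - min a b) \<le> N \<and> u (min a b) = u (min a b + (max a b - min a b))"
        by (cases a b rule: linorder_cases) auto
      then show ?thesis by blast
    qed
    define d where "d = (LEAST d. 0 < d \<and> (\<exists>i. i + d \<le> N \<and> u i = u (i + d)))"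
    obtain i where d: "0 < d" "i + d \<le> N" "u i = u (i + d)"
      using LeastI_ex[OF ex] unfolding d_def[symmetric] by auto
    have minimal: "d \<le> d'" if "0 < d'" "i' + d' \<le> N" "u i' = u (i' + d')" for i' d'
      unfolding d_def using that by (intro Least_le) auto
    \<comment> \<open>Distance 1 would be a self-loop and distance 2 a backtracking step, so the
      closed piece has at least the 3 vertices that a cycle needs.\<close>
    have "d \<noteq> 1" "d \<noteq> 2" using d(3) une[of i] unb[of i] by auto
    then have d3: "3 \<le> d" using d(1) by linarith
    define ws where "ws = map u [i..<i + d]"
    have len: "length ws = d" by (simp add: ws_def)
    have nth: "ws ! k = u (i + k)" if "k < d" for k using that by (simp add: ws_def)
    have "distinct ws"
    proof -
      have False if "a < b" "b < d" "u (i + a) = u (i + b)" for a b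
        using minimal[of "b - a" "i + a"] that d(2) by simp
      then show ?thesis unfolding distinct_conv_nth len by (metis linorder_neqE_nat nth)
    qed
    moreover have "set ws \<subseteq> V" using uV by (auto simp: ws_def)
    moreover have "\<forall>k<length ws. {ws ! k, ws ! ((k + 1) mod length ws)} \<in> EA"
    proof (intro allI impI)
      fix k assume "k < length ws"
      then have k: "k < d" using len by simp
      have "ws ! ((k + 1) mod d) = u (i + k + 1)"
      proof (cases "k + 1 = d")
        case True
        then have "i + k + 1 = i + d" by simp
        then have "u (i + k + 1) = u i" using d(3) by (simp only:)
        then show ?thesis using True nth[of 0] d(1) by simp
      next
        case False
        then show ?thesis using k nth[of "k + 1"] by simp
      qed
      then show "{ws ! k, ws ! ((k + 1) mod length ws)} \<in> EA"
        using uEA[of "i + k"] k d(2) len nth[OF k] by simp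
    qed
    ultimately show False using acyclic d3 len unfolding acyclic_graph_def by metis
  qed
  then obtain f where f: "\<And>j. f j < N \<and> (j + f j) mod n \<in> I" by metis
  \<comment> \<open>The start \<open>j\<close> is recovered from the non-forest step that is hit and
    its offset in the window; counting such pairs bounds \<open>n\<close> by
    \<open>card I * N\<close>.\<close>
  have "inj_on (\<lambda>j. ((j + f j) mod n, f j)) {..<n}"
  proof -
    have le: False if "j < j'" "j' < n" "(j + k) mod n = (j' + k) mod n" for j j' k
    proof -
      have "n dvd (j' + k) - (j + k)" using that mod_eq_dvd_iff_nat[of "j + k" "j' + k" n] by simp
      then show False using that by (auto dest: dvd_imp_le)
    qed
    show ?thesis
    proof (rule inj_onI)
      fix a b assume "a \<in> {..<n}" "b \<in> {..<n}" "((a + f a) mod n, f a) = ((b + f b) mod n, f b)"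
      then show "a = b" using le[of a b "f a"] le[of b a "f a"] by (cases a b rule: linorder_cases) auto
    qed
  qed
  moreover have "(\<lambda>j. ((j + f j) mod n, f j)) ` {..<n} \<subseteq> I \<times> {..<N}" using f by auto
  moreover have "finite (I \<times> {..<N})" by (simp add: I_def)
  ultimately have "card {..<n} \<le> card (I \<times> {..<N})" by (rule card_inj_on_le)
  then show ?thesis by (simp add: card_cartesian_product n_def N_def I_def loop_len_def mult.commute)
qed

lemma loop_len_le: "loop_len EA vs \<le> length vs"
proof -
  have "loop_len EA vs \<le> card {..<length vs}" unfolding loop_len_def by (intro card_mono) auto
  then show ?thesis by simp
qed

lemma sum_list_mono_map: "(\<And>l. l \<in> set c \<Longrightarrow> f l \<le> g l) \<Longrightarrow> sum_list (map f c) \<le> sum_list (map g c)"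
  for f g :: "'a \<Rightarrow> nat"
  by (induction c) (auto intro!: add_mono)

context plane_drawing
begin

lemma loop_weight_walk_weight: "loop_weight pos x l = walk_weight l / of_nat (loop_mult l)"
  by (simp add: loop_weight_def walk_weight_def)

lemma closed_gpath_set: "closed_gpath E vs \<Longrightarrow> set vs \<subseteq> V"
  using edge_ends(1) by (fastforce simp: closed_gpath_def in_set_conv_nth)

end

section \<open>The expansion graded by length, then by steps outside the forest\<close>

lemma graded_expansion:
  fixes V :: "'v::linorder set"
  assumes "plane_graph V E pos"
  defines "conf \<equiv> \<lambda>n. {c. set c \<subseteq> gloops E \<and> sum_list (map length c) = n}"
  shows "finite (conf n)"
    "(\<Sum>c\<in>conf n. 1 / of_nat (fact (length c)) * (\<Prod>l\<leftarrow>c. loop_weight pos x l)) =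
      (\<Sum>F | even_subgraph V E F \<and> card F = n. (-1) ^ num_crossings V pos F * (\<Prod>e\<in>F. x e))"
proof -
  interpret plane_drawing V E pos x by unfold_locales (rule assms)
  have finC: "finite {vs. closed_gpath E vs \<and> length vs = n}" for n
    by (rule finite_subset[OF _ finite_lists_length_eq[OF finite_V, of n]]) (use closed_gpath_set in auto)
  have finG: "finite {l \<in> gloops E. length l = n}" for n
    by (rule finite_subset[OF _ finC[of n]]) (auto simp: gloops_def is_gloop_def)
  have pos: "0 < length l" if "l \<in> gloops E" for l
    using that by (auto simp: gloops_def is_gloop_def closed_gpath_def)
  have exp: "(\<Sum>c\<in>conf n. 1 / of_nat (fact (length c)) * (\<Prod>l\<leftarrow>c. loop_weight pos x l)) =
      (fps_exp 1 oo Abs_fps (\<lambda>n. \<Sum>l\<in>{l \<in> gloops E. length l = n}. loop_weight pos x l)) $ n"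
    unfolding conf_def by (rule sum_configs_fps_exp(2)[OF finG pos])
  show "finite (conf n)" unfolding conf_def by (rule sum_configs_fps_exp(1)[OF finG pos])
  let ?L = "Abs_fps (\<lambda>n. \<Sum>l\<in>{l \<in> gloops E. length l = n}. loop_weight pos x l)"
  have noloop: "{v} \<notin> E" for v using edge_ends(3)[of v v] by auto
  have L: "2 * of_nat n * ?L $ n = (\<Sum>vs | closed_gpath E vs \<and> length vs = n. walk_weight vs)" for n
    using sum_gloops[OF finC noloop walk_weight_rotate1 walk_weight_rev, of n]
    by (simp add: loop_weight_walk_weight)
  have "{l \<in> gloops E. length l = 0} = {}" using pos by fastforce
  then have L0: "?L $ 0 = 0" by (simp only: fps_nth_Abs_fps sum.empty)
  have "(fps_exp 1 oo ?L) $ n = part n"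
  proof (rule fps_exp_compose_unique[where p = part, OF L0 part_0])
    fix n
    have "2 * (of_nat (Suc n) * part (Suc n)) = (\<Sum>k\<le>n. part (n - k) * (2 * of_nat (Suc k) * ?L $ Suc k))"
      unfolding L using even_subgraph_recursion[of n] by (simp only: mult.assoc)
    also have "\<dots> = 2 * (\<Sum>k\<le>n. part (n - k) * (of_nat (Suc k) * ?L $ Suc k))"
      unfolding sum_distrib_left by (intro sum.cong refl) (simp only: mult_ac)
    finally show "of_nat (Suc n) * part (Suc n) = (\<Sum>k\<le>n. part (n - k) * (of_nat (Suc k) * ?L $ Suc k))"
      by simp
  qed
  then show "(\<Sum>c\<in>conf n. 1 / of_nat (fact (length c)) * (\<Prod>l\<leftarrow>c. loop_weight pos x l)) =
      (\<Sum>F | even_subgraph V E F \<and> card F = n. (-1) ^ num_crossings V pos F * (\<Prod>e\<in>F. x e))"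
    unfolding exp part_eq_even_subgraphs .
qed

lemma loop_weight_scale:
  "loop_weight pos (\<lambda>e. if e \<in> EA then x e else t * x e) l = t ^ loop_len EA l * loop_weight pos x l"
proof -
  let ?e = "\<lambda>i. {l ! i, l ! ((i + 1) mod length l)}"
  have "(\<Prod>i<length l. if ?e i \<in> EA then x (?e i) else t * x (?e i)) =
      (\<Prod>i<length l. (if ?e i \<notin> EA then t else 1) * x (?e i))"
    by (rule prod.cong) auto
  also have "\<dots> = (\<Prod>i<length l. if ?e i \<notin> EA then t else 1) * (\<Prod>i<length l. x (?e i))"
    by (rule prod.distrib)
  also have "(\<Prod>i<length l. if ?e i \<notin> EA then t else 1) = (\<Prod>i\<in>{i. i < length l \<and> ?e i \<notin> EA}. t)"
    by (rule prod.mono_neutral_cong_right) auto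
  finally show ?thesis by (simp add: loop_weight_def loop_len_def)
qed

lemma edge_prod_scale:
  fixes x :: "'e \<Rightarrow> complex"
  assumes "finite F"
  shows "(\<Prod>e\<in>F. if e \<in> EA then x e else t * x e) = t ^ card (F - EA) * (\<Prod>e\<in>F. x e)"
proof -
  have "(\<Prod>e\<in>F. if e \<in> EA then x e else t * x e) = (\<Prod>e\<in>F. (if e \<notin> EA then t else 1) * x e)"
    by (rule prod.cong) auto
  also have "\<dots> = (\<Prod>e\<in>F. if e \<notin> EA then t else 1) * (\<Prod>e\<in>F. x e)" by (rule prod.distrib)
  also have "(\<Prod>e\<in>F. if e \<notin> EA then t else 1) = (\<Prod>e\<in>F - EA. t)"
    by (rule prod.mono_neutral_cong_right) (use assms in auto)
  finally show ?thesis by simp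
qed

lemma config_weight_scale:
  "(\<Prod>l\<leftarrow>c. loop_weight pos (\<lambda>e. if e \<in> EA then x e else t * x e) l) =
    t ^ sum_list (map (loop_len EA) c) * (\<Prod>l\<leftarrow>c. loop_weight pos x l)"
  by (induction c) (simp_all add: loop_weight_scale power_add)

lemma sum_by_degree:
  fixes f :: "'a \<Rightarrow> complex"
  assumes "finite S" "\<And>s. s \<in> S \<Longrightarrow> g s \<le> (n::nat)"
  shows "(\<Sum>s\<in>S. t ^ g s * f s) = (\<Sum>i\<le>n. (\<Sum>s | s \<in> S \<and> g s = i. f s) * t ^ i)"
proof -
  have "(\<Sum>s\<in>S. t ^ g s * f s) = (\<Sum>i\<le>n. \<Sum>s | s \<in> S \<and> g s = i. t ^ g s * f s)"
    by (rule sum.group[symmetric]) (use assms in auto)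
  also have "\<dots> = (\<Sum>i\<le>n. (\<Sum>s | s \<in> S \<and> g s = i. f s) * t ^ i)"
    unfolding sum_distrib_right by (intro sum.cong refl) (auto simp: mult.commute)
  finally show ?thesis .
qed

text \<open>\<open>graded_expansion\<close> holds for all weights, in particular with those outside
  \<open>EA\<close> multiplied by \<open>t\<close>. For fixed \<open>n\<close> both sides are then
  polynomials in \<open>t\<close> of degree at most \<open>n\<close> that agree at every complex
  \<open>t\<close>, so their coefficients agree.\<close>

lemma bigraded_expansion:
  fixes V :: "'v::linorder set"
  assumes "plane_graph V E pos"
  shows "(\<Sum>c | (set c \<subseteq> gloops E \<and> sum_list (map length c) = n) \<and> sum_list (map (loop_len EA) c) = r.
      1 / of_nat (fact (length c)) * (\<Prod>l\<leftarrow>c. loop_weight pos x l)) =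
    (\<Sum>F | (even_subgraph V E F \<and> card F = n) \<and> card (F - EA) = r.
      (-1) ^ num_crossings V pos F * (\<Prod>e\<in>F. x e))"
proof -
  interpret plane_drawing V E pos x by unfold_locales (rule assms)
  let ?C = "{c. set c \<subseteq> gloops E \<and> sum_list (map length c) = n}"
  let ?F = "{F. even_subgraph V E F \<and> card F = n}"
  let ?f = "\<lambda>c. 1 / of_nat (fact (length c)) * (\<Prod>l\<leftarrow>c. loop_weight pos x l) :: complex"
  let ?g = "\<lambda>F. (-1) ^ num_crossings V pos F * (\<Prod>e\<in>F. x e)"
  have finC: "finite ?C" by (rule graded_expansion(1)[OF assms])
  have finF: "finite ?F"
    by (rule finite_subset[of _ "Pow E"]) (auto simp: even_subgraph_def finite_E)
  have finite_F: "finite F" if "even_subgraph V E F" for F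
    using that finite_E finite_subset by (auto simp: even_subgraph_def)
  have degC: "sum_list (map (loop_len EA) c) \<le> n" if "c \<in> ?C" for c
    using sum_list_mono_map[of c "loop_len EA" length] loop_len_le that by auto
  have degF: "card (F - EA) \<le> n" if "F \<in> ?F" for F
    using that finite_F card_mono[of F "F - EA"] by auto
  have polys: "(\<Sum>i\<le>n. (\<Sum>c | c \<in> ?C \<and> sum_list (map (loop_len EA) c) = i. ?f c) * t ^ i) =
      (\<Sum>i\<le>n. (\<Sum>F | F \<in> ?F \<and> card (F - EA) = i. ?g F) * t ^ i)" for t
  proof -
    let ?x = "\<lambda>e. if e \<in> EA then x e else t * x e"
    have "(\<Sum>i\<le>n. (\<Sum>c | c \<in> ?C \<and> sum_list (map (loop_len EA) c) = i. ?f c) * t ^ i) =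
        (\<Sum>c\<in>?C. t ^ sum_list (map (loop_len EA) c) * ?f c)"
      by (rule sum_by_degree[where g = "\<lambda>c. sum_list (map (loop_len EA) c)", OF finC degC, symmetric])
    also have "\<dots> = (\<Sum>c\<in>?C. 1 / of_nat (fact (length c)) * (\<Prod>l\<leftarrow>c. loop_weight pos ?x l))"
      unfolding config_weight_scale by (intro sum.cong refl) (simp only: mult_ac)
    also have "\<dots> = (\<Sum>F\<in>?F. (-1) ^ num_crossings V pos F * (\<Prod>e\<in>F. ?x e))"
      by (rule graded_expansion(2)[OF assms])
    also have "\<dots> = (\<Sum>F\<in>?F. t ^ card (F - EA) * ?g F)"
      using finite_F by (intro sum.cong refl) (simp add: edge_prod_scale mult_ac)
    also have "\<dots> = (\<Sum>i\<le>n. (\<Sum>F | F \<in> ?F \<and> card (F - EA) = i. ?g F) * t ^ i)"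
      by (rule sum_by_degree[where g = "\<lambda>F. card (F - EA)", OF finF degF])
    finally show ?thesis .
  qed
  have coeff: "\<forall>i\<le>n. (\<Sum>c | c \<in> ?C \<and> sum_list (map (loop_len EA) c) = i. ?f c) =
      (\<Sum>F | F \<in> ?F \<and> card (F - EA) = i. ?g F)"
    by (rule iffD1[OF polyfun_eq_coeffs], rule allI, rule polys)
  show ?thesis
  proof (cases "r \<le> n")
    case True
    then show ?thesis using coeff by simp
  next
    case False
    then have "{c. c \<in> ?C \<and> sum_list (map (loop_len EA) c) = r} = {}"
      "{F. F \<in> ?F \<and> card (F - EA) = r} = {}" using degC degF by fastforce+
    then show ?thesis by (simp only: mem_Collect_eq sum.empty)
  qed
qed

theorem mainTheorem8:
  fixes V :: "'v::linorder set" and E EA :: "'v set set"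
    and pos :: "'v \<Rightarrow> complex" and x :: "'v set \<Rightarrow> complex"
  assumes "plane_graph V E pos"
    and "EA \<subseteq> E" and "acyclic_graph V EA"
  shows "(\<forall>r \<ge> 1. finite (loop_configs E EA r)) \<and>
         (\<lambda>r. \<Sum>c \<in> loop_configs E EA (Suc r).
               (1 / of_nat (fact (length c))) * (\<Prod>l \<leftarrow> c. loop_weight pos x l))
           sums (Zpart V E pos x - 1)"
proof -
  interpret plane_drawing V E pos x by unfold_locales (rule assms)
  let ?f = "\<lambda>c. (1 / of_nat (fact (length c))) * (\<Prod>l \<leftarrow> c. loop_weight pos x l)"
  let ?g = "\<lambda>F. (-1) ^ num_crossings V pos F * (\<Prod>e\<in>F. x e)"
  have cl: "closed_gpath E l" if "l \<in> gloops E" for l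
    using that by (simp add: gloops_def is_gloop_def)
  have bound: "length l \<le> card V * loop_len EA l" if "l \<in> gloops E" for l
    using loop_length_bound[OF finite_V _ assms(3) cl[OF that]] edge_ends by blast
  \<comment> \<open>By \<open>bound\<close>, a loop without steps outside \<open>EA\<close> would
    have length 0.\<close>
  have len_pos: "0 < loop_len EA l" if "l \<in> gloops E" for l
    using bound[OF that] cl[OF that] by (auto simp: closed_gpath_def intro: gr0I)
  have total: "sum_list (map length c) \<le> card V * r" if c: "c \<in> loop_configs E EA r" for c r
  proof -
    have "sum_list (map length c) \<le> sum_list (map (\<lambda>l. card V * loop_len EA l) c)"
      by (rule sum_list_mono_map) (use c bound in \<open>auto simp: loop_configs_def\<close>)
    then show ?thesis using c by (simp add: loop_configs_def sum_list_const_mult)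
  qed
  have configs_Un: "loop_configs E EA r = (\<Union>n\<le>card V * r.
      {c. (set c \<subseteq> gloops E \<and> sum_list (map length c) = n) \<and> sum_list (map (loop_len EA) c) = r})" for r
    using total by (auto simp: loop_configs_def)
  have fin: "finite (loop_configs E EA r)" for r
    unfolding configs_Un
  proof (rule finite_UN_I)
    show "finite {c. (set c \<subseteq> gloops E \<and> sum_list (map length c) = n) \<and> sum_list (map (loop_len EA) c) = r}" for n
      by (rule finite_subset[OF _ graded_expansion(1)[OF assms(1), of n]]) auto
  qed simp
  have finF: "finite {F. even_subgraph V E F}"
    by (rule finite_subset[of _ "Pow E"]) (auto simp: even_subgraph_def finite_E)
  have card_F: "card F \<le> card E" "card (F - EA) \<le> card E" if "even_subgraph V E F" for F
    using that finite_E by (auto simp: even_subgraph_def intro!: card_mono)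
  have coeff: "(\<Sum>c\<in>loop_configs E EA r. ?f c) = (\<Sum>F | even_subgraph V E F \<and> card (F - EA) = r. ?g F)" for r
  proof -
    \<comment> \<open>Large enough for both sides: the first summand bounds the total length of a
      configuration, the second the size of an even subgraph.\<close>
    let ?N = "card V * r + card E"
    have "(\<Sum>c\<in>loop_configs E EA r. ?f c) =
        (\<Sum>n\<le>?N. \<Sum>c | c \<in> loop_configs E EA r \<and> sum_list (map length c) = n. ?f c)"
      by (rule sum.group[symmetric]) (use fin total in \<open>auto intro: trans_le_add1\<close>)
    also have "\<dots> = (\<Sum>n\<le>?N. \<Sum>F | (even_subgraph V E F \<and> card F = n) \<and> card (F - EA) = r. ?g F)"
      unfolding bigraded_expansion[OF assms(1), symmetric]
      by (intro sum.cong refl) (auto simp: loop_configs_def)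
    also have "\<dots> = (\<Sum>n\<le>?N. \<Sum>F | F \<in> {F. even_subgraph V E F \<and> card (F - EA) = r} \<and> card F = n. ?g F)"
      by (intro sum.cong refl) auto
    also have "\<dots> = (\<Sum>F | even_subgraph V E F \<and> card (F - EA) = r. ?g F)"
      by (rule sum.group) (use finF card_F in \<open>auto intro: trans_le_add2\<close>)
    finally show ?thesis .
  qed
  \<comment> \<open>Every loop leaves the forest, so only the empty configuration has degree 0; it
    is the separate 1 in the statement.\<close>
  have zero: "(\<Sum>c\<in>loop_configs E EA 0. ?f c) = 1"
  proof -
    have "c = []" if "c \<in> loop_configs E EA 0" for c
      using that by (cases c) (auto simp: loop_configs_def dest: len_pos)
    then have "loop_configs E EA 0 = {[]}" by (auto simp: loop_configs_def)
    then show ?thesis by simp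
  qed
  have "Zpart V E pos x = (\<Sum>r\<le>card E. \<Sum>F | F \<in> {F. even_subgraph V E F} \<and> card (F - EA) = r. ?g F)"
    unfolding Zpart_def by (rule sum.group[symmetric]) (use finF card_F in auto)
  also have "\<dots> = (\<Sum>r\<le>card E. \<Sum>c\<in>loop_configs E EA r. ?f c)"
    by (simp only: coeff mem_Collect_eq)
  also have "\<dots> = 1 + (\<Sum>r<card E. \<Sum>c\<in>loop_configs E EA (Suc r). ?f c)"
    by (simp only: lessThan_Suc_atMost[symmetric] sum.lessThan_Suc_shift zero)
  finally have Z: "Zpart V E pos x - 1 = (\<Sum>r<card E. \<Sum>c\<in>loop_configs E EA (Suc r). ?f c)"
    by simp
  have "(\<lambda>r. \<Sum>c\<in>loop_configs E EA (Suc r). ?f c) sums (Zpart V E pos x - 1)"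
    unfolding Z
  \<comment> \<open>The series terminates: no even subgraph has more than \<open>card E\<close>
    edges outside \<open>EA\<close>, so by \<open>coeff\<close> the later terms vanish although they
    may contain configurations.\<close>
  proof (rule sums_finite)
    fix r assume "r \<notin> {..<card E}"
    then have "{F. even_subgraph V E F \<and> card (F - EA) = Suc r} = {}"
      using card_F(2) by fastforce
    then show "(\<Sum>c\<in>loop_configs E EA (Suc r). ?f c) = 0" unfolding coeff by (simp only: sum.empty)
  qed simp
  then show ?thesis using fin by blast
qed

end
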